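(* Let $\kappa \le \infty$ be an uncountable regular cardinal. If a category with pullbacks $\mathcal{C}$ has reflexive coequalizers and $\kappa$-small filtered colimits, then $\mathcal{C}$ has $\kappa$-small sifted colimits, and these are preserved by any functor $F : \mathcal{C} \to \mathcal{D}$ (to any category $\mathcal{D}$) preserving reflexive coequalizers and $\kappa$-small filtered colimits.
   Context: Categories are locally small by default. Here $\infty$ denotes the bound on the fixed universe of small sets, so "$\infty$-small" means small; for a regular cardinal $\kappa$, "$\kappa$-small" means of size $<\kappa$ (a category is $\kappa$-small if it has fewer than $\kappa$ morphisms). A category is sifted if the category of cocones over any finite (possibly empty) discrete family of objects in it is connected (in particular nonempty). A $\kappa$-small sifted (resp. filtered) colimit is a colimit of a diagram indexed by a $\kappa$-small sifted (resp. filtered) category. A reflexive coequalizer is a coequalizer of a parallel pair $p,q : X \rightrightarrows Y$ with a common section $r : Y \to X$ ($pr=qr=1_Y$). *)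

theory Defs
  imports Main
begin

unbundle cardinal_syntax

section \<open>Categories and functors\<close>

record ('o, 'a) cat =
  Obj :: "'o set"
  Arr :: "'a set"
  Dom :: "'a \<Rightarrow> 'o"
  Cod :: "'a \<Rightarrow> 'o"
  Id :: "'o \<Rightarrow> 'a"
  Comp :: "'a \<Rightarrow> 'a \<Rightarrow> 'a"  (* Comp C g f is g after f *)

definition hom :: "('o, 'a) cat \<Rightarrow> 'o \<Rightarrow> 'o \<Rightarrow> 'a set" where
  "hom C x y = {f \<in> Arr C. Dom C f = x \<and> Cod C f = y}"

locale category =
  fixes C :: "('o, 'a) cat"
  assumes Dom_Obj: "f \<in> Arr C \<Longrightarrow> Dom C f \<in> Obj C"
    and Cod_Obj: "f \<in> Arr C \<Longrightarrow> Cod C f \<in> Obj C"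
    and Id_hom: "x \<in> Obj C \<Longrightarrow> Id C x \<in> hom C x x"
    and Comp_hom: "\<lbrakk>f \<in> hom C x y; g \<in> hom C y z\<rbrakk> \<Longrightarrow> Comp C g f \<in> hom C x z"
    and Id_left: "f \<in> hom C x y \<Longrightarrow> Comp C (Id C y) f = f"
    and Id_right: "f \<in> hom C x y \<Longrightarrow> Comp C f (Id C x) = f"
    and Comp_assoc: "\<lbrakk>f \<in> hom C w x; g \<in> hom C x y; h \<in> hom C y z\<rbrakk>
        \<Longrightarrow> Comp C h (Comp C g f) = Comp C (Comp C h g) f"

record ('o, 'a, 'p, 'b) functr =
  FOb :: "'o \<Rightarrow> 'p"
  FAr :: "'a \<Rightarrow> 'b"

locale is_functor = S: category C + T: category D
  for C :: "('o, 'a) cat" and D :: "('p, 'b) cat"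
    and F :: "('o, 'a, 'p, 'b) functr" +
  assumes FOb_Obj: "x \<in> Obj C \<Longrightarrow> FOb F x \<in> Obj D"
    and FAr_hom: "f \<in> hom C x y \<Longrightarrow> FAr F f \<in> hom D (FOb F x) (FOb F y)"
    and FAr_Id: "x \<in> Obj C \<Longrightarrow> FAr F (Id C x) = Id D (FOb F x)"
    and FAr_Comp: "\<lbrakk>f \<in> hom C x y; g \<in> hom C y z\<rbrakk>
        \<Longrightarrow> FAr F (Comp C g f) = Comp D (FAr F g) (FAr F f)"

definition functor_comp ::
  "('p, 'b, 'q, 'c) functr \<Rightarrow> ('o, 'a, 'p, 'b) functr \<Rightarrow> ('o, 'a, 'q, 'c) functr" where
  "functor_comp G F = \<lparr>FOb = FOb G \<circ> FOb F, FAr = FAr G \<circ> FAr F\<rparr>"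

definition locally_small :: "'u rel \<Rightarrow> ('o, 'a) cat \<Rightarrow> bool" where
  "locally_small U C \<longleftrightarrow> (\<forall>x\<in>Obj C. \<forall>y\<in>Obj C. |hom C x y| <o U)"

definition small_cat :: "'k rel \<Rightarrow> ('o, 'a) cat \<Rightarrow> bool" where
  "small_cat \<kappa> J \<longleftrightarrow> |Arr J| <o \<kappa>"


section \<open>Cocones and colimits\<close>

definition is_cocone ::
  "('j, 'i) cat \<Rightarrow> ('o, 'a) cat \<Rightarrow> ('j, 'i, 'o, 'a) functr \<Rightarrow> 'o \<Rightarrow> ('j \<Rightarrow> 'a) \<Rightarrow> bool" where
  "is_cocone J C T x t \<longleftrightarrow> x \<in> Obj C \<and>
     (\<forall>j\<in>Obj J. t j \<in> hom C (FOb T j) x) \<and>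
     (\<forall>u\<in>Arr J. Comp C (t (Cod J u)) (FAr T u) = t (Dom J u))"

definition is_colimit ::
  "('j, 'i) cat \<Rightarrow> ('o, 'a) cat \<Rightarrow> ('j, 'i, 'o, 'a) functr \<Rightarrow> 'o \<Rightarrow> ('j \<Rightarrow> 'a) \<Rightarrow> bool" where
  "is_colimit J C T x t \<longleftrightarrow> is_cocone J C T x t \<and>
     (\<forall>y s. is_cocone J C T y s \<longrightarrow>
        (\<exists>!h. h \<in> hom C x y \<and> (\<forall>j\<in>Obj J. Comp C h (t j) = s j)))"

(* An object is a vertex with its family of legs; the legs are undefined outside the index
   objects, so that equal cocones are equal as pairs.  An arrow carries its domain and codomain. *)
definition cocone_cat ::
  "('j, 'i) cat \<Rightarrow> ('o, 'a) cat \<Rightarrow> ('j, 'i, 'o, 'a) functr \<Rightarrow>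
     ('o \<times> ('j \<Rightarrow> 'a), ('o \<times> ('j \<Rightarrow> 'a)) \<times> 'a \<times> ('o \<times> ('j \<Rightarrow> 'a))) cat" where
  "cocone_cat J C T =
    (let K = {(x, t). is_cocone J C T x t \<and> (\<forall>j. j \<notin> Obj J \<longrightarrow> t j = undefined)} in
    \<lparr>Obj = K,
     Arr = {((x, t), h, (y, s)) | x t h y s. (x, t) \<in> K \<and> (y, s) \<in> K \<and>
              h \<in> hom C x y \<and> (\<forall>j\<in>Obj J. Comp C h (t j) = s j)},
     Dom = (\<lambda>(c, h, d). c),
     Cod = (\<lambda>(c, h, d). d),
     Id = (\<lambda>c. (c, Id C (fst c), c)),
     Comp = (\<lambda>(d, g, e) (c, h, d'). (c, Comp C g h, e))\<rparr>)"

lemma category_cocone_cat: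
  assumes "is_functor J C T"
  shows "category (cocone_cat J C T)"
proof -
  interpret is_functor J C T by (fact assms)
  have legs: "t j \<in> hom C (FOb T j) x" if "is_cocone J C T x t" "j \<in> Obj J" for x t j
    using that by (auto simp: is_cocone_def)
  show ?thesis
  proof (unfold_locales, goal_cases)
    case (3 c)
    then obtain x t where c: "c = (x, t)" and cc: "is_cocone J C T x t"
      by (auto simp: cocone_cat_def)
    have "x \<in> Obj C"
      using cc by (simp add: is_cocone_def)
    with 3 c show ?case
      using T.Id_hom T.Id_left[OF legs[OF cc]] by (auto simp: cocone_cat_def hom_def)
  next
    case (4 f c d g e)
    then obtain x t y s z r h k where
      f: "f = ((x, t), h, (y, s))" "c = (x, t)" "d = (y, s)" and
      g: "g = ((y, s), k, (z, r))" "e = (z, r)" and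
      ob: "c \<in> Obj (cocone_cat J C T)" "e \<in> Obj (cocone_cat J C T)" and
      cc: "is_cocone J C T x t" and
      h: "h \<in> hom C x y" "\<And>j. j \<in> Obj J \<Longrightarrow> Comp C h (t j) = s j" and
      k: "k \<in> hom C y z" "\<And>j. j \<in> Obj J \<Longrightarrow> Comp C k (s j) = r j"
      by (auto simp: cocone_cat_def hom_def Let_def)
    have "Comp C (Comp C k h) (t j) = r j" if "j \<in> Obj J" for j
      using T.Comp_assoc[OF legs[OF cc that] h(1) k(1)] h(2) k(2) that by simp
    with f g ob T.Comp_hom[OF h(1) k(1)] show ?case
      by (auto simp: cocone_cat_def hom_def Let_def)
  qed (auto simp: cocone_cat_def hom_def Let_def
      intro: T.Id_left[unfolded hom_def] T.Id_right[unfolded hom_def]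
        T.Comp_assoc[unfolded hom_def])
qed


section \<open>Sifted and filtered categories\<close>

definition connected_cat :: "('o, 'a) cat \<Rightarrow> bool" where
  "connected_cat C \<longleftrightarrow> Obj C \<noteq> {} \<and>
     (\<forall>x\<in>Obj C. \<forall>y\<in>Obj C. (x, y) \<in> {(v, w). hom C v w \<noteq> {} \<or> hom C w v \<noteq> {}}\<^sup>*)"

definition discrete_cat :: "'i set \<Rightarrow> ('i, 'i) cat" where
  "discrete_cat I = \<lparr>Obj = I, Arr = I, Dom = id, Cod = id, Id = id, Comp = (\<lambda>g f. f)\<rparr>"

definition discrete_diagram :: "('o, 'a) cat \<Rightarrow> ('i \<Rightarrow> 'o) \<Rightarrow> ('i, 'i, 'o, 'a) functr" where
  "discrete_diagram C X = \<lparr>FOb = X, FAr = (\<lambda>i. Id C (X i))\<rparr>"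

lemma is_functor_discrete_diagram:
  assumes "category C" and "\<And>i. i \<in> I \<Longrightarrow> X i \<in> Obj C"
  shows "is_functor (discrete_cat I) C (discrete_diagram C X)"
proof -
  interpret category C by fact
  have "Comp C (Id C (X i)) (Id C (X i)) = Id C (X i)" if "i \<in> I" for i
    using Id_left[OF Id_hom] assms(2)[OF that] by blast
  then show ?thesis
    by unfold_locales
      (use assms(2) Id_hom in \<open>auto simp: discrete_cat_def discrete_diagram_def hom_def
        intro: Dom_Obj Cod_Obj Id_left[unfolded hom_def] Id_right[unfolded hom_def]
          Comp_hom[unfolded hom_def, simplified] Comp_assoc[unfolded hom_def]\<close>)
qed

(* A finite family is reindexed as X 0, ..., X (n - 1); n = 0 is the empty family. *)
definition sifted :: "('o, 'a) cat \<Rightarrow> bool" where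
  "sifted C \<longleftrightarrow> (\<forall>(n::nat) X. (\<forall>i<n. X i \<in> Obj C) \<longrightarrow>
     connected_cat (cocone_cat (discrete_cat {..<n}) C (discrete_diagram C X)))"

definition filtered :: "('o, 'a) cat \<Rightarrow> bool" where
  "filtered C \<longleftrightarrow> Obj C \<noteq> {} \<and>
     (\<forall>x\<in>Obj C. \<forall>y\<in>Obj C. \<exists>z\<in>Obj C. hom C x z \<noteq> {} \<and> hom C y z \<noteq> {}) \<and>
     (\<forall>x\<in>Obj C. \<forall>y\<in>Obj C. \<forall>f\<in>hom C x y. \<forall>g\<in>hom C x y.
        \<exists>z\<in>Obj C. \<exists>h\<in>hom C y z. Comp C h f = Comp C h g)"


section \<open>Existence and preservation of colimits of a given shape\<close>

(* The index categories have their objects and arrows in the type 'k underlying the cardinal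
   order.  A category with fewer than |Field \<kappa>| arrows has at most as many objects (via
   identities), so it is isomorphic to one of these: no index category is lost. *)
definition has_small_colimits ::
  "'k rel \<Rightarrow> (('k, 'k) cat \<Rightarrow> bool) \<Rightarrow> ('o, 'a) cat \<Rightarrow> bool" where
  "has_small_colimits \<kappa> P C \<longleftrightarrow>
     (\<forall>(J :: ('k, 'k) cat) T. category J \<and> small_cat \<kappa> J \<and> P J \<and> is_functor J C T \<longrightarrow>
        (\<exists>x t. is_colimit J C T x t))"

definition preserves_small_colimits ::
  "'k rel \<Rightarrow> (('k, 'k) cat \<Rightarrow> bool) \<Rightarrow> ('o, 'a) cat \<Rightarrow> ('p, 'b) cat \<Rightarrow>
     ('o, 'a, 'p, 'b) functr \<Rightarrow> bool" where
  "preserves_small_colimits \<kappa> P C D F \<longleftrightarrow>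
     (\<forall>(J :: ('k, 'k) cat) T x t.
        category J \<and> small_cat \<kappa> J \<and> P J \<and> is_functor J C T \<and> is_colimit J C T x t \<longrightarrow>
        is_colimit J D (functor_comp F T) (FOb F x) (\<lambda>j. FAr F (t j)))"


section \<open>Reflexive coequalizers and pullbacks\<close>

definition reflexive_pair :: "('o, 'a) cat \<Rightarrow> 'o \<Rightarrow> 'o \<Rightarrow> 'a \<Rightarrow> 'a \<Rightarrow> bool" where
  "reflexive_pair C x y p q \<longleftrightarrow> x \<in> Obj C \<and> y \<in> Obj C \<and> p \<in> hom C x y \<and> q \<in> hom C x y \<and>
     (\<exists>r\<in>hom C y x. Comp C p r = Id C y \<and> Comp C q r = Id C y)"

(* For a parallel pair p, q with common codomain y, and e from y to z. *)
definition is_coequalizer :: "('o, 'a) cat \<Rightarrow> 'o \<Rightarrow> 'a \<Rightarrow> 'a \<Rightarrow> 'o \<Rightarrow> 'a \<Rightarrow> bool" where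
  "is_coequalizer C y p q z e \<longleftrightarrow> z \<in> Obj C \<and> e \<in> hom C y z \<and> Comp C e p = Comp C e q \<and>
     (\<forall>w\<in>Obj C. \<forall>f\<in>hom C y w. Comp C f p = Comp C f q \<longrightarrow>
        (\<exists>!h. h \<in> hom C z w \<and> Comp C h e = f))"

definition has_reflexive_coequalizers :: "('o, 'a) cat \<Rightarrow> bool" where
  "has_reflexive_coequalizers C \<longleftrightarrow>
     (\<forall>x y p q. reflexive_pair C x y p q \<longrightarrow> (\<exists>z e. is_coequalizer C y p q z e))"

definition preserves_reflexive_coequalizers ::
  "('o, 'a) cat \<Rightarrow> ('p, 'b) cat \<Rightarrow> ('o, 'a, 'p, 'b) functr \<Rightarrow> bool" where
  "preserves_reflexive_coequalizers C D F \<longleftrightarrow>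
     (\<forall>x y p q z e. reflexive_pair C x y p q \<and> is_coequalizer C y p q z e \<longrightarrow>
        is_coequalizer D (FOb F y) (FAr F p) (FAr F q) (FOb F z) (FAr F e))"

definition is_pullback ::
  "('o, 'a) cat \<Rightarrow> 'o \<Rightarrow> 'o \<Rightarrow> 'a \<Rightarrow> 'a \<Rightarrow> 'o \<Rightarrow> 'a \<Rightarrow> 'a \<Rightarrow> bool" where
  "is_pullback C x y f g w p q \<longleftrightarrow> w \<in> Obj C \<and> p \<in> hom C w x \<and> q \<in> hom C w y \<and>
     Comp C f p = Comp C g q \<and>
     (\<forall>v\<in>Obj C. \<forall>a\<in>hom C v x. \<forall>b\<in>hom C v y. Comp C f a = Comp C g b \<longrightarrow>
        (\<exists>!h. h \<in> hom C v w \<and> Comp C p h = a \<and> Comp C q h = b))"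

definition has_pullbacks :: "('o, 'a) cat \<Rightarrow> bool" where
  "has_pullbacks C \<longleftrightarrow>
     (\<forall>x\<in>Obj C. \<forall>y\<in>Obj C. \<forall>z\<in>Obj C. \<forall>f\<in>hom C x z. \<forall>g\<in>hom C y z.
        \<exists>w p q. is_pullback C x y f g w p q)"

end

theory Submission
  imports Defs
begin

text \<open>
  Let \<open>E\<close> be the colimit, among presheaves on \<open>C\<close>, of the representables \<open>C(-, T j)\<close> for a sifted
  diagram \<open>T\<close> of shape \<open>J\<close>. An element of \<open>E\<close> at \<open>c\<close> is an arrow \<open>c \<rightarrow> T j\<close> up to zigzags in \<open>J\<close>, and a
  cocone on \<open>T\<close> is the same as a compatible choice of an arrow out of \<open>c\<close> for every element of \<open>E\<close>
  at \<open>c\<close>, or, by the Yoneda lemma, for every arrow from the representable \<open>c\<close> to \<open>E\<close>. The idea is to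
  present \<open>E\<close> as a filtered colimit of quotients of representables by reflexive pairs. These quotients
  can be formed in \<open>C\<close> instead of among presheaves, because this does not change the cocones.

  The key is \<open>reflexive_pair_identifying\<close>. Suppose that finitely many pairs \<open>f i, g i\<close> of arrows into
  \<open>x\<close> become equal on composing with an element \<open>a\<close> of \<open>E\<close> at \<open>x\<close>. Since \<open>J\<close> is sifted, the families
  \<open>(a, a f i)\<close> and \<open>(a, a g i)\<close> are connected by a single zigzag
  \<open>T z0 \<rightarrow> T z1 \<leftarrow> T z2 \<rightarrow> \<dots> \<leftarrow> T zn\<close> through which all their entries factor compatibly
  (\<open>fam_eq_if_el_eq\<close>). Let \<open>P\<close> be its limit, an iterated pullback, with projections \<open>u\<close> and \<open>v\<close> to the
  two ends (\<open>zigzag_limit\<close>). All the arrows of the zigzag assemble into one arrow \<open>s: x \<rightarrow> P\<close> with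
  \<open>u s = v s = a\<close> and into arrows \<open>k i\<close> into \<open>P\<close> with \<open>u (s f i) = u (k i)\<close> and \<open>v (k i) = v (s g i)\<close>.
  Hence the composite of the kernel pairs of \<open>u\<close> and \<open>v\<close> relates \<open>s f i\<close> to \<open>s g i\<close>. This composite is
  a reflexive pair, again by pullbacks, and it only relates arrows that are equal in \<open>E\<close>. So however
  long the zigzag is, one reflexive pair identifies its ends.

  Consider the category whose objects are the elements \<open>f\<close> of \<open>E\<close> at some \<open>y\<close> together with a reflexive
  coequalizer \<open>e: y \<rightarrow> z\<close> of a pair that is equal in \<open>E\<close>, and whose arrows are the arrows between the
  vertices \<open>z\<close> that lift to arrows over \<open>E\<close>. The key fact makes it filtered (\<open>filtered_quot_cat\<close>): it
  makes the relations of two given objects hold in a common quotient, and it coequalizes parallel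
  arrows. This category is not small, but a closure argument yields a filtered subcategory with fewer
  than \<open>\<kappa>\<close> arrows that contains a copy of the diagram \<open>T\<close> (\<open>ex_small_final_arrows\<close>); the closure is a
  countable union, which is why \<open>\<kappa>\<close> has to be uncountable. Cocones on \<open>T\<close> are the same as cocones on
  the filtered diagram of the vertices \<open>z\<close>, because a cocone on \<open>T\<close> coequalizes every pair that is equal
  in \<open>E\<close>. The same holds after applying a functor that preserves reflexive coequalizers
  (\<open>is_colimit_restrict_iff\<close>). For the identity functor this gives the existence of the colimit of
  \<open>T\<close>, and for a functor that also preserves filtered colimits it gives the preservation.
\<close>

section \<open>Arrows and coequalizers\<close>

context category
begin

lemma hom_Obj:
  assumes "f \<in> hom C x y"
  shows "x \<in> Obj C" and "y \<in> Obj C"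
  using assms Dom_Obj Cod_Obj by (auto simp: hom_def)

lemma in_hom: "f \<in> Arr C \<Longrightarrow> f \<in> hom C (Dom C f) (Cod C f)"
  by (simp add: hom_def)

lemma hom_Arr: "f \<in> hom C x y \<Longrightarrow> f \<in> Arr C \<and> Dom C f = x \<and> Cod C f = y"
  by (simp add: hom_def)

lemma coequalizer_factor:
  assumes "is_coequalizer C y p q z e" and "f \<in> hom C y w" and "Comp C f p = Comp C f q"
  obtains h where "h \<in> hom C z w" "Comp C h e = f"
  using assms hom_Obj(2)[OF assms(2)] unfolding is_coequalizer_def by blast

lemma coequalizer_epi:
  assumes e: "is_coequalizer C y p q z e" and pq: "p \<in> hom C x y" "q \<in> hom C x y"
    and g: "g \<in> hom C z w" and h: "h \<in> hom C z w" and eq: "Comp C g e = Comp C h e"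
  shows "g = h"
proof -
  have e': "e \<in> hom C y z" "Comp C e p = Comp C e q"
    using e by (auto simp: is_coequalizer_def)
  have "Comp C (Comp C g e) p = Comp C (Comp C g e) q"
    using Comp_assoc[OF pq(1) e'(1) g] Comp_assoc[OF pq(2) e'(1) g] e'(2) by simp
  then have "\<exists>!k. k \<in> hom C z w \<and> Comp C k e = Comp C g e"
    using e Comp_hom[OF e'(1) g] hom_Obj(2)[OF g] by (auto simp: is_coequalizer_def)
  then show ?thesis
    using g h eq by metis
qed

lemma reflexive_pair_Id: "y \<in> Obj C \<Longrightarrow> reflexive_pair C y y (Id C y) (Id C y)"
  using Id_hom Id_left[OF Id_hom] by (auto simp: reflexive_pair_def)

lemma is_coequalizer_Id: "y \<in> Obj C \<Longrightarrow> is_coequalizer C y (Id C y) (Id C y) y (Id C y)"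
  using Id_hom by (auto simp: is_coequalizer_def Id_right)

end

section \<open>Small filtered subcategories\<close>

definition closed_arrows :: "('o, 'a) cat \<Rightarrow> 'a set \<Rightarrow> bool" where
  "closed_arrows G B \<longleftrightarrow> B \<subseteq> Arr G \<and>
     (\<forall>f\<in>B. Id G (Dom G f) \<in> B \<and> Id G (Cod G f) \<in> B) \<and>
     (\<forall>f\<in>B. \<forall>g\<in>B. Cod G f = Dom G g \<longrightarrow> Comp G g f \<in> B)"

definition subcat :: "('o, 'a) cat \<Rightarrow> 'a set \<Rightarrow> ('o, 'a) cat" where
  "subcat G B = G\<lparr>Obj := {x \<in> Obj G. Id G x \<in> B}, Arr := B\<rparr>"

lemma hom_subcat: "closed_arrows G B \<Longrightarrow> hom (subcat G B) x y = hom G x y \<inter> B"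
  by (auto simp: hom_def subcat_def closed_arrows_def)

lemma category_subcat:
  assumes "category G" and B: "closed_arrows G B"
  shows "category (subcat G B)"
proof -
  interpret category G by fact
  show ?thesis
  proof
    show "Dom (subcat G B) f \<in> Obj (subcat G B)" "Cod (subcat G B) f \<in> Obj (subcat G B)"
      if "f \<in> Arr (subcat G B)" for f
      using that B Dom_Obj Cod_Obj by (auto simp: subcat_def closed_arrows_def)
    show "Id (subcat G B) x \<in> hom (subcat G B) x x" if "x \<in> Obj (subcat G B)" for x
      using that Id_hom unfolding hom_subcat[OF B] by (auto simp: subcat_def)
    show "Comp (subcat G B) g f \<in> hom (subcat G B) x z"
      if "f \<in> hom (subcat G B) x y" "g \<in> hom (subcat G B) y z" for f g x y z
      using that B Comp_hom[of f x y g z] unfolding hom_subcat[OF B]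
      by (auto simp: subcat_def closed_arrows_def hom_def)
    show "Comp (subcat G B) (Id (subcat G B) y) f = f" "Comp (subcat G B) f (Id (subcat G B) x) = f"
      if "f \<in> hom (subcat G B) x y" for f x y
      using that Id_left Id_right unfolding hom_subcat[OF B] by (auto simp: subcat_def)
    show "Comp (subcat G B) h (Comp (subcat G B) g f) = Comp (subcat G B) (Comp (subcat G B) h g) f"
      if "f \<in> hom (subcat G B) w x" "g \<in> hom (subcat G B) x y" "h \<in> hom (subcat G B) y z"
      for f g h w x y z
      using that Comp_assoc[of f w x g y h z] unfolding hom_subcat[OF B] by (simp add: subcat_def)
  qed
qed

lemma is_functor_subcat:
  assumes "is_functor G C T" and B: "closed_arrows G B"
  shows "is_functor (subcat G B) C T"
proof -
  interpret is_functor G C T by fact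
  interpret K: category "subcat G B"
    using category_subcat[OF S.category_axioms B] .
  show ?thesis
  proof
    show "FOb T x \<in> Obj C" "FAr T (Id (subcat G B) x) = Id C (FOb T x)"
      if "x \<in> Obj (subcat G B)" for x
      using that FOb_Obj FAr_Id by (simp_all add: subcat_def)
    show "FAr T f \<in> hom C (FOb T x) (FOb T y)" if "f \<in> hom (subcat G B) x y" for f x y
      using that FAr_hom[of f x y] unfolding hom_subcat[OF B] by simp
    show "FAr T (Comp (subcat G B) g f) = Comp C (FAr T g) (FAr T f)"
      if "f \<in> hom (subcat G B) x y" "g \<in> hom (subcat G B) y z" for f g x y z
      using that FAr_Comp[of f x y g z] unfolding hom_subcat[OF B] by (simp add: subcat_def)
  qed
qed

text \<open>
  The stages of the closure are indexed by the natural numbers, and a binary operation with finite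
  values does not enlarge an infinite cardinal.
\<close>

lemma finitary_closure:
  assumes A: "A \<subseteq> X" and op: "\<And>x y. \<lbrakk>x \<in> X; y \<in> X\<rbrakk> \<Longrightarrow> finite (op x y) \<and> op x y \<subseteq> X"
  shows "\<exists>B. A \<subseteq> B \<and> B \<subseteq> X \<and> (\<forall>x\<in>B. \<forall>y\<in>B. op x y \<subseteq> B) \<and>
    |B| \<le>o |A <+> (UNIV :: nat set)|"
proof -
  define S where "S = rec_nat A (\<lambda>_ S. S \<union> (\<Union>(x, y)\<in>S \<times> S. op x y))"
  have S: "S 0 = A" "S (Suc n) = S n \<union> (\<Union>(x, y)\<in>S n \<times> S n. op x y)" for n
    by (simp_all add: S_def)
  have mono: "S m \<subseteq> S n" if "m \<le> n" for m n
    using that by (induction rule: dec_induct) (auto simp: S)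
  let ?M = "A <+> (UNIV :: nat set)"
  have inf: "\<not> finite (Field |?M| )"
    by (simp add: Field_card_of finite_Plus_iff)
  note card = card_of_Card_order[of ?M]
  have SX: "S n \<subseteq> X" for n
  proof (induction n)
    case (Suc n)
    then have "op x y \<subseteq> X" if "x \<in> S n" "y \<in> S n" for x y
      using op that by blast
    with Suc show ?case by (auto simp: S)
  qed (use A in \<open>simp add: S\<close>)
  have "|S n| \<le>o |?M|" for n
  proof (induction n)
    case 0
    then show ?case by (simp add: S card_of_Plus1)
  next
    case (Suc n)
    have "natLeq \<le>o |?M|"
      using inf infinite_iff_natLeq_ordLeq[of ?M] by (simp add: Field_card_of)
    moreover have "|op x y| \<le>o natLeq" if "(x, y) \<in> S n \<times> S n" for x y
    proof -
      have "finite (op x y)"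
        using op[of x y] subsetD[OF SX[of n]] that by simp
      then show ?thesis
        using finite_iff_ordLess_natLeq[of "op x y"] by (simp add: ordLess_imp_ordLeq)
    qed
    ultimately have "|op x y| \<le>o |?M|" if "(x, y) \<in> S n \<times> S n" for x y
      using that by (meson ordLeq_transitive)
    then have "|\<Union>(x, y)\<in>S n \<times> S n. op x y| \<le>o |?M|"
      by (intro card_of_UNION_ordLeq_infinite_Field[OF inf card]
          card_of_Times_ordLeq_infinite_Field[OF inf Suc Suc card]) auto
    then show ?case
      unfolding S by (rule card_of_Un_ordLeq_infinite_Field[OF inf Suc _ card])
  qed
  then have "|\<Union>n. S n| \<le>o |?M|"
    by (intro card_of_UNION_ordLeq_infinite_Field[OF inf card card_of_Plus2]) simp
  moreover have "op x y \<subseteq> (\<Union>n. S n)" if xy: "x \<in> (\<Union>n. S n)" "y \<in> (\<Union>n. S n)" for x y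
  proof -
    obtain m n where "x \<in> S m" "y \<in> S n"
      using xy by blast
    then have "x \<in> S (max m n)" "y \<in> S (max m n)"
      using mono[of m "max m n"] mono[of n "max m n"] by auto
    then have "op x y \<subseteq> S (Suc (max m n))"
      by (auto simp: S)
    then show ?thesis by blast
  qed
  moreover have "A \<subseteq> (\<Union>n. S n)"
    using S(1) by blast
  moreover have "(\<Union>n. S n) \<subseteq> X"
    using SX by blast
  ultimately show ?thesis by blast
qed

text \<open>
  Filteredness asserts the existence of single arrows for at most two given ones, so a
  Loewenheim--Skolem closure preserves it. The closure of a finite set may be countably infinite,
  hence the bound has to exceed \<open>natLeq\<close>. The sets \<open>N g\<close> impose further closure conditions.
\<close>

lemma small_filtered_subcat:
  fixes \<kappa> :: "'k rel"
  assumes "category G" and "filtered G" and A: "A \<subseteq> Arr G" "A \<noteq> {}" "|A| <o \<kappa>"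
    and \<kappa>: "Card_order \<kappa>" "natLeq <o \<kappa>"
    and N: "\<And>g. g \<in> Arr G \<Longrightarrow> finite (N g) \<and> N g \<subseteq> Arr G"
  obtains B where "A \<subseteq> B" "closed_arrows G B" "filtered (subcat G B)" "|B| <o \<kappa>"
    "\<forall>g\<in>B. N g \<subseteq> B"
proof -
  interpret category G by fact
  have "\<exists>u v. \<exists>z\<in>Obj G. u \<in> hom G x z \<and> v \<in> hom G y z" if "x \<in> Obj G" "y \<in> Obj G" for x y
    using \<open>filtered G\<close> that unfolding filtered_def by blast
  then obtain U V Z where UV: "\<And>x y. \<lbrakk>x \<in> Obj G; y \<in> Obj G\<rbrakk> \<Longrightarrow>
      U x y \<in> hom G x (Z x y) \<and> V x y \<in> hom G y (Z x y)"
    by metis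
  have "\<exists>h. h \<in> Arr G \<and> Dom G h = Cod G f \<and> Comp G h f = Comp G h g"
    if fg: "f \<in> Arr G" "g \<in> Arr G" "Dom G f = Dom G g" "Cod G f = Cod G g" for f g
  proof -
    have "f \<in> hom G (Dom G f) (Cod G f)" "g \<in> hom G (Dom G f) (Cod G f)"
      using fg by (auto simp: hom_def)
    then have "\<exists>z\<in>Obj G. \<exists>h\<in>hom G (Cod G f) z. Comp G h f = Comp G h g"
      using \<open>filtered G\<close> Dom_Obj[OF fg(1)] Cod_Obj[OF fg(1)] unfolding filtered_def by blast
    then show ?thesis by (auto simp: hom_def)
  qed
  then obtain E where E: "\<And>f g. \<lbrakk>f \<in> Arr G; g \<in> Arr G; Dom G f = Dom G g; Cod G f = Cod G g\<rbrakk> \<Longrightarrow>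
      E f g \<in> Arr G \<and> Dom G (E f g) = Cod G f \<and> Comp G (E f g) f = Comp G (E f g) g"
    by metis
  \<comment> \<open>Objects are represented by arrows with that domain, so that one operation on arrows suffices.\<close>
  define op where "op f g = {Id G (Dom G f), Id G (Cod G f), U (Dom G f) (Dom G g), V (Dom G f) (Dom G g)} \<union>
      (if Cod G f = Dom G g then {Comp G g f} else {}) \<union>
      (if Dom G f = Dom G g \<and> Cod G f = Cod G g then {E f g} else {}) \<union> N f" for f g
  have op: "finite (op f g) \<and> op f g \<subseteq> Arr G" if fg: "f \<in> Arr G" "g \<in> Arr G" for f g
  proof -
    have "Comp G g f \<in> Arr G" if "Cod G f = Dom G g"
      using Comp_hom[of f "Dom G f" "Dom G g" g "Cod G g"] fg that by (auto simp: hom_def)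
    then show ?thesis
      using fg N[OF fg(1)] E[OF fg] UV[OF Dom_Obj[OF fg(1)] Dom_Obj[OF fg(2)]]
        Id_hom[OF Dom_Obj[OF fg(1)]] Id_hom[OF Cod_Obj[OF fg(1)]]
      by (auto simp: op_def hom_def)
  qed
  obtain B where B: "A \<subseteq> B" "B \<subseteq> Arr G" "\<And>f g. \<lbrakk>f \<in> B; g \<in> B\<rbrakk> \<Longrightarrow> op f g \<subseteq> B"
    "|B| \<le>o |A <+> (UNIV :: nat set)|"
    using finitary_closure[OF A(1), of op] op by metis
  have "natLeq \<le>o |Field \<kappa>|"
    using \<kappa> by (meson card_of_Field_ordIso ordIso_symmetric ordLess_imp_ordLeq ordLeq_ordIso_trans)
  then have "\<not> finite (Field \<kappa>)"
    using infinite_iff_natLeq_ordLeq by blast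
  moreover have "|UNIV :: nat set| <o \<kappa>"
    using card_of_nat \<kappa>(2) by (rule ordIso_ordLess_trans)
  ultimately have "|A <+> (UNIV :: nat set)| <o \<kappa>"
    using card_of_Plus_ordLess_infinite_Field[OF _ \<kappa>(1) A(3)] by blast
  with B(4) have small: "|B| <o \<kappa>"
    by (rule ordLeq_ordLess_trans)
  have closed: "closed_arrows G B"
    unfolding closed_arrows_def
  proof (intro conjI ballI impI)
    fix f g
    assume f: "f \<in> B" and g: "g \<in> B"
    show "Id G (Dom G f) \<in> B" "Id G (Cod G f) \<in> B"
      using B(3)[OF f f] by (simp_all add: op_def)
    show "Comp G g f \<in> B" if "Cod G f = Dom G g"
      using B(3)[OF f g] that by (simp add: op_def)
  qed (rule B(2))
  have NB: "\<forall>g\<in>B. N g \<subseteq> B"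
    using B(3) by (simp add: op_def)
  have "filtered (subcat G B)"
    unfolding filtered_def
  proof (intro conjI ballI)
    interpret K: category "subcat G B"
      using category_subcat[OF category_axioms closed] .
    show "Obj (subcat G B) \<noteq> {}"
      using A(2) B(1) K.Dom_Obj by (force simp: subcat_def)
    fix x y
    assume x: "x \<in> Obj (subcat G B)" and y: "y \<in> Obj (subcat G B)"
    then have xy: "x \<in> Obj G" "y \<in> Obj G" "Id G x \<in> B" "Id G y \<in> B"
      by (auto simp: subcat_def)
    then have "Dom G (Id G x) = x" "Dom G (Id G y) = y"
      using Id_hom by (auto simp: hom_def)
    then have "U x y \<in> B" "V x y \<in> B"
      using B(3)[OF xy(3,4)] by (auto simp: op_def)
    then have "U x y \<in> hom (subcat G B) x (Z x y)" "V x y \<in> hom (subcat G B) y (Z x y)"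
      using UV[OF xy(1,2)] by (auto simp: hom_subcat[OF closed])
    then show "\<exists>z\<in>Obj (subcat G B). hom (subcat G B) x z \<noteq> {} \<and> hom (subcat G B) y z \<noteq> {}"
      using K.hom_Obj by blast
    fix f g
    assume "f \<in> hom (subcat G B) x y" "g \<in> hom (subcat G B) x y"
    then have fg: "f \<in> B" "g \<in> B" "f \<in> hom G x y" "g \<in> hom G x y"
      by (auto simp: hom_subcat[OF closed])
    then have "E f g \<in> B"
      using B(3)[OF fg(1,2)] by (auto simp: op_def hom_def)
    moreover have "E f g \<in> hom G y (Cod G (E f g))" "Comp G (E f g) f = Comp G (E f g) g"
      using E[of f g] fg by (auto simp: hom_def)
    ultimately have "E f g \<in> hom (subcat G B) y (Cod G (E f g))"
      "Comp (subcat G B) (E f g) f = Comp (subcat G B) (E f g) g"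
      by (simp_all add: hom_subcat[OF closed]) (simp add: subcat_def)
    then show "\<exists>z\<in>Obj (subcat G B). \<exists>h\<in>hom (subcat G B) y z.
        Comp (subcat G B) h f = Comp (subcat G B) h g"
      using K.hom_Obj by blast
  qed
  from that[OF B(1) closed this small NB] show thesis .
qed

section \<open>Zigzags of elements\<close>

context is_functor
begin

text \<open>
  For a diagram \<open>F\<close> of shape \<open>C\<close> in \<open>D\<close>, the pair of \<open>j\<close> and \<open>f: c \<rightarrow> F j\<close> represents an element at
  \<open>c\<close> of the presheaf colimit of the representables \<open>D(-, F j)\<close>. Two pairs represent the same element
  iff they are related by the equivalence closure \<open>el_eq\<close>.
\<close>

definition el_step :: "'o \<times> 'b \<Rightarrow> 'o \<times> 'b \<Rightarrow> bool" where
  "el_step e e' \<longleftrightarrow> snd e \<in> Arr D \<and> Cod D (snd e) = FOb F (fst e) \<and>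
     (\<exists>m\<in>hom C (fst e) (fst e'). snd e' = Comp D (FAr F m) (snd e))"

abbreviation el_eq :: "'o \<times> 'b \<Rightarrow> 'o \<times> 'b \<Rightarrow> bool" where
  "el_eq \<equiv> equivclp el_step"

lemma el_stepD:
  assumes "el_step (j, f) (j', f')"
  obtains m where "m \<in> hom C j j'" "f \<in> hom D (Dom D f) (FOb F j)"
    "f' = Comp D (FAr F m) f" "f' \<in> hom D (Dom D f) (FOb F j')"
proof -
  from assms obtain m where m: "m \<in> hom C j j'" "f \<in> hom D (Dom D f) (FOb F j)"
    "f' = Comp D (FAr F m) f"
    by (auto simp: el_step_def hom_def)
  with T.Comp_hom[OF m(2) FAr_hom[OF m(1)]] that show thesis by simp
qed

lemma el_eq_map:
  assumes "m \<in> hom C j j'" and "f \<in> hom D c (FOb F j)"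
  shows "el_eq (j, f) (j', Comp D (FAr F m) f)"
  by (rule r_into_equivclp) (use assms in \<open>auto simp: el_step_def hom_def\<close>)

lemma el_eq_hom:
  assumes "el_eq (j, f) (j', f')" and "j \<in> Obj C" and "f \<in> hom D c (FOb F j)"
  shows "j' \<in> Obj C" and "f' \<in> hom D c (FOb F j')"
proof -
  have "fst e \<in> Obj C \<and> snd e \<in> hom D c (FOb F (fst e))" if "el_eq (j, f) e" for e
    using that
  proof (induction rule: equivclp_induct)
    case base
    then show ?case using assms by simp
  next
    case (step y z)
    obtain k g l h where yz: "y = (k, g)" "z = (l, h)" by fastforce
    from step(2) show ?case
    proof
      assume "el_step y z"
      then obtain m where "m \<in> hom C k l" "h \<in> hom D (Dom D g) (FOb F l)"
        unfolding yz by (rule el_stepD)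
      with step(3) S.hom_Obj show ?case by (auto simp: yz hom_def)
    next
      assume "el_step z y"
      then obtain m where "m \<in> hom C l k" "h \<in> hom D (Dom D h) (FOb F l)"
        "g \<in> hom D (Dom D h) (FOb F k)"
        unfolding yz by (rule el_stepD)
      with step(3) S.hom_Obj show ?case by (auto simp: yz hom_def)
    qed
  qed
  from this[OF assms(1)] show "j' \<in> Obj C" "f' \<in> hom D c (FOb F j')" by simp_all
qed

lemma el_eq_precomp:
  assumes "el_eq (j, f) (j', f')" and "f \<in> hom D c (FOb F j)" and "g \<in> hom D b c"
  shows "el_eq (j, Comp D f g) (j', Comp D f' g)"
proof -
  have *: "el_step (fst e, Comp D (snd e) g) (fst e', Comp D (snd e') g)"
    if st: "el_step e e'" and dom: "Dom D (snd e) = c" for e e'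
  proof -
    from st obtain m where m: "m \<in> hom C (fst e) (fst e')" and
      e: "snd e \<in> hom D c (FOb F (fst e))" and e': "snd e' = Comp D (FAr F m) (snd e)"
      using dom by (metis el_stepD prod.collapse)
    show ?thesis
      using m T.Comp_assoc[OF assms(3) e FAr_hom[OF m]] T.Comp_hom[OF assms(3) e]
      by (auto simp: el_step_def e' hom_def)
  qed
  have "Dom D (snd e) = c \<and> el_eq (j, Comp D f g) (fst e, Comp D (snd e) g)"
    if "el_eq (j, f) e" for e
    using that
  proof (induction rule: equivclp_induct)
    case base
    then show ?case using assms by (simp add: hom_def)
  next
    case (step y z)
    have dom: "Dom D (snd z) = c"
      using step(2)
    proof
      assume "el_step y z"
      then show ?thesis using step(3) by (metis el_stepD prod.collapse T.hom_Arr)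
    next
      assume "el_step z y"
      then show ?thesis using step(3) by (metis el_stepD prod.collapse T.hom_Arr)
    qed
    from step(2) show ?case
    proof
      assume "el_step y z"
      from *[OF this] step(3) dom show ?case
        by (meson equivclp_trans r_into_equivclp)
    next
      assume "el_step z y"
      from *[OF this dom] step(3) dom show ?case
        by (meson equivclp_trans equivclp_sym r_into_equivclp)
    qed
  qed
  from this[OF assms(1)] show ?thesis by simp
qed

end

text \<open>
  A cocone is a natural map out of the presheaf of elements, so it respects \<open>el_eq\<close>.
\<close>

lemma cocone_legs_el_eq:
  assumes "is_functor J C T" and "is_functor C D F"
    and s: "is_cocone J D (functor_comp F T) w s"
    and eq: "is_functor.el_eq J C T (j, f) (j', f')"
    and "j \<in> Obj J" and "f \<in> hom C c (FOb T j)"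
  shows "Comp D (s j) (FAr F f) = Comp D (s j') (FAr F f')"
proof -
  interpret T: is_functor J C T by fact
  interpret F: is_functor C D F by fact
  have *: "Comp D (s (fst e)) (FAr F (snd e)) = Comp D (s (fst e')) (FAr F (snd e'))"
    if st: "T.el_step e e'" for e e'
  proof -
    obtain m where m: "m \<in> hom J (fst e) (fst e')"
      and e: "snd e \<in> hom C (Dom C (snd e)) (FOb T (fst e))"
      and e': "snd e' = Comp C (FAr T m) (snd e)"
      using st by (metis T.el_stepD prod.collapse)
    have leg: "s (fst e') \<in> hom D (FOb F (FOb T (fst e'))) w"
      and nat: "Comp D (s (fst e')) (FAr F (FAr T m)) = s (fst e)"
      using s m T.S.hom_Obj[OF m] by (auto simp: is_cocone_def functor_comp_def hom_def)
    show ?thesis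
      using F.T.Comp_assoc[OF F.FAr_hom[OF e] F.FAr_hom[OF T.FAr_hom[OF m]] leg]
        F.FAr_Comp[OF e T.FAr_hom[OF m]] nat e' by simp
  qed
  have "Comp D (s (fst e)) (FAr F (snd e)) = Comp D (s (fst e')) (FAr F (snd e'))"
    if "T.el_eq e e'" for e e'
    using that by (induction rule: equivclp_induct) (use * in metis)+
  from this[OF eq] show ?thesis by simp
qed

section \<open>Families of elements over a sifted diagram\<close>

locale sifted_diagram = is_functor J C T
  for J :: "('j, 'i) cat" and C :: "('o, 'a) cat" and T :: "('j, 'i, 'o, 'a) functr" +
  assumes sifted: "sifted J"
begin

text \<open>
  A family consists of an index \<open>z\<close> and of \<open>N\<close> arrows into the one object \<open>T z\<close>. A step moves all entries
  along the same arrow of \<open>J\<close>; so \<open>fam_eq\<close> provides a common zigzag, whereas \<open>el_eq\<close> for each entry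
  provides unrelated zigzags. The typing of the source is part of a step because \<open>zigzag_limit\<close> also
  traverses steps backwards.
\<close>

definition fam_step :: "nat \<Rightarrow> 'j \<times> (nat \<Rightarrow> 'a) \<Rightarrow> 'j \<times> (nat \<Rightarrow> 'a) \<Rightarrow> bool" where
  "fam_step N A B \<longleftrightarrow> (\<exists>m\<in>hom J (fst A) (fst B).
     \<forall>i<N. snd A i \<in> Arr C \<and> Cod C (snd A i) = FOb T (fst A) \<and>
       snd B i = Comp C (FAr T m) (snd A i))"

abbreviation fam_eq :: "nat \<Rightarrow> 'j \<times> (nat \<Rightarrow> 'a) \<Rightarrow> 'j \<times> (nat \<Rightarrow> 'a) \<Rightarrow> bool" where
  "fam_eq N \<equiv> equivclp (fam_step N)"

definition rep_family :: "nat \<Rightarrow> (nat \<Rightarrow> 'o) \<Rightarrow> (nat \<Rightarrow> 'j \<times> 'a) \<Rightarrow> bool" where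
  "rep_family N d \<rho> \<longleftrightarrow>
     (\<forall>i<N. fst (\<rho> i) \<in> Obj J \<and> snd (\<rho> i) \<in> hom C (d i) (FOb T (fst (\<rho> i))))"

text \<open>
  The representatives \<open>\<rho> i\<close> may live at different indices; a cocone \<open>\<mu>\<close> over these indices in \<open>J\<close> moves
  them into one object and so turns them into a family \<open>A\<close>.
\<close>

definition merges :: "nat \<Rightarrow> (nat \<Rightarrow> 'j \<times> 'a) \<Rightarrow> 'j \<times> (nat \<Rightarrow> 'a) \<Rightarrow> bool" where
  "merges N \<rho> A \<longleftrightarrow> fst A \<in> Obj J \<and> (\<exists>\<mu>. \<forall>i<N. \<mu> i \<in> hom J (fst (\<rho> i)) (fst A) \<and>
     snd A i = Comp C (FAr T (\<mu> i)) (snd (\<rho> i)))"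

lemma is_cocone_discrete:
  assumes "k \<in> Obj J" and "\<And>i. i < N \<Longrightarrow> \<mu> i \<in> hom J (X i) k"
  shows "is_cocone (discrete_cat {..<N}) J (discrete_diagram J X) k \<mu>"
  using assms S.Id_right[OF assms(2)]
  by (auto simp: is_cocone_def discrete_cat_def discrete_diagram_def)

lemma connected_cocones:
  fixes N :: nat
  assumes "\<And>i. i < N \<Longrightarrow> X i \<in> Obj J"
  shows "connected_cat (cocone_cat (discrete_cat {..<N}) J (discrete_diagram J X))"
  using sifted assms unfolding sifted_def by blast

lemma ex_cocone:
  fixes N :: nat
  assumes "\<And>i. i < N \<Longrightarrow> X i \<in> Obj J"
  obtains k \<mu> where "k \<in> Obj J" and "\<And>i. i < N \<Longrightarrow> \<mu> i \<in> hom J (X i) k"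
proof -
  have "Obj (cocone_cat (discrete_cat {..<N}) J (discrete_diagram J X)) \<noteq> {}"
    using connected_cocones[of N X] assms by (simp add: connected_cat_def)
  then show thesis
    using that
    by (auto simp: cocone_cat_def is_cocone_def discrete_cat_def discrete_diagram_def)
qed

lemma fam_eq_cong:
  assumes "k \<in> Obj J" and "\<And>i. i < N \<Longrightarrow> \<kappa> i \<in> hom C (d i) (FOb T k)"
    and "\<And>i. i < N \<Longrightarrow> \<kappa>' i = \<kappa> i"
  shows "fam_eq N (k, \<kappa>) (k, \<kappa>')"
  by (rule r_into_equivclp)
    (use assms S.Id_hom FAr_Id T.Id_left[OF assms(2)] T.hom_Arr[OF assms(2)] in
      \<open>auto simp: fam_step_def intro!: bexI[of _ "Id J k"]\<close>)

text \<open>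
  Arrows of cocones over the indices of \<open>\<rho>\<close> induce steps of families, and by siftedness the category
  of these cocones is connected.
\<close>

lemma merges_fam_eq:
  assumes \<rho>: "rep_family N d \<rho>" and A: "merges N \<rho> A" and B: "merges N \<rho> B"
  shows "fam_eq N A B"
proof -
  let ?K = "cocone_cat (discrete_cat {..<N}) J (discrete_diagram J (\<lambda>i. fst (\<rho> i)))"
  define fam where "fam v = (fst v, \<lambda>i. Comp C (FAr T (snd v i)) (snd (\<rho> i)))"
    for v :: "'j \<times> (nat \<Rightarrow> 'i)"
  have rep: "fst (\<rho> i) \<in> Obj J" "snd (\<rho> i) \<in> hom C (d i) (FOb T (fst (\<rho> i)))" if "i < N" for i
    using \<rho> that by (auto simp: rep_family_def)
  have ob: "\<exists>v\<in>Obj ?K. fam_eq N A (fam v)" if A: "merges N \<rho> A" for A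
  proof -
    obtain \<mu> where k: "fst A \<in> Obj J" and
      \<mu>: "\<And>i. i < N \<Longrightarrow> \<mu> i \<in> hom J (fst (\<rho> i)) (fst A)"
        "\<And>i. i < N \<Longrightarrow> snd A i = Comp C (FAr T (\<mu> i)) (snd (\<rho> i))"
      using A by (auto simp: merges_def)
    \<comment> \<open>The objects of the category of cocones have undefined legs outside the index set.\<close>
    let ?v = "(fst A, \<lambda>i. if i < N then \<mu> i else undefined)"
    have "?v \<in> Obj ?K"
      using is_cocone_discrete[OF k, of N "snd ?v" "\<lambda>i. fst (\<rho> i)"] \<mu>
      by (auto simp: cocone_cat_def discrete_cat_def)
    moreover have "snd A i \<in> hom C (d i) (FOb T (fst A))" if "i < N" for i
      using T.Comp_hom[OF rep(2)[OF that] FAr_hom[OF \<mu>(1)[OF that]]] \<mu>(2)[OF that] by simp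
    then have "fam_eq N (fst A, snd A) (fam ?v)"
      unfolding fam_def fst_conv
      by (intro fam_eq_cong[OF k]) (use \<mu> in auto)
    ultimately show ?thesis by auto
  qed
  have arrow: "fam_step N (fam v) (fam w)" if "hom ?K v w \<noteq> {}" for v w
  proof -
    obtain k \<mu> l \<nu> h where v: "v = (k, \<mu>)" "w = (l, \<nu>)" and h: "h \<in> hom J k l"
      and \<mu>: "\<And>i. i < N \<Longrightarrow> \<mu> i \<in> hom J (fst (\<rho> i)) k"
      and \<nu>: "\<And>i. i < N \<Longrightarrow> Comp J h (\<mu> i) = \<nu> i"
      using \<open>hom ?K v w \<noteq> {}\<close>
      by (auto simp: hom_def cocone_cat_def is_cocone_def discrete_cat_def discrete_diagram_def)
    have "Comp C (FAr T (\<nu> i)) (snd (\<rho> i)) =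
        Comp C (FAr T h) (Comp C (FAr T (\<mu> i)) (snd (\<rho> i)))" if "i < N" for i
      using T.Comp_assoc[OF rep(2)[OF that] FAr_hom[OF \<mu>[OF that]] FAr_hom[OF h]]
        FAr_Comp[OF \<mu>[OF that] h] \<nu>[OF that] by simp
    moreover have "Comp C (FAr T (\<mu> i)) (snd (\<rho> i)) \<in> hom C (d i) (FOb T k)" if "i < N" for i
      using T.Comp_hom[OF rep(2)[OF that] FAr_hom[OF \<mu>[OF that]]] .
    ultimately show ?thesis
      using h by (auto simp: fam_step_def fam_def v hom_def[of C])
  qed
  obtain v w where v: "v \<in> Obj ?K" "fam_eq N A (fam v)" and w: "w \<in> Obj ?K" "fam_eq N B (fam w)"
    using ob[OF A] ob[OF B] by blast
  have "(v, w) \<in> {(v, w). hom ?K v w \<noteq> {} \<or> hom ?K w v \<noteq> {}}\<^sup>*"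
    using connected_cocones[of N "\<lambda>i. fst (\<rho> i)"] rep(1) v(1) w(1) by (auto simp: connected_cat_def)
  then have "fam_eq N (fam v) (fam w)"
  proof (induction rule: rtrancl_induct)
    case (step y z)
    then show ?case
      using arrow
      by (smt (verit) case_prodD equivclp_sym equivclp_trans mem_Collect_eq r_into_equivclp)
  qed simp
  with v(2) w(2) show ?thesis
    by (meson equivclp_sym equivclp_trans)
qed

lemma ex_merges:
  assumes "rep_family N d \<rho>"
  obtains A where "merges N \<rho> A"
proof -
  obtain k \<mu> where "k \<in> Obj J" "\<And>i. i < N \<Longrightarrow> \<mu> i \<in> hom J (fst (\<rho> i)) k"
    using ex_cocone[of N "\<lambda>i. fst (\<rho> i)"] assms by (auto simp: rep_family_def)
  then have "merges N \<rho> (k, \<lambda>i. Comp C (FAr T (\<mu> i)) (snd (\<rho> i)))"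
    by (auto simp: merges_def)
  then show thesis by (rule that)
qed

text \<open>
  Precomposing the \<open>i\<close>-th leg of the cocone with the arrow of the step leaves the family unchanged.
\<close>

lemma merges_el_step:
  assumes st: "el_step (\<rho> i) e" and i: "i < N" and A: "merges N (\<rho>(i := e)) A"
  shows "merges N \<rho> A"
proof -
  obtain m where m: "m \<in> hom J (fst (\<rho> i)) (fst e)"
    and \<rho>i: "snd (\<rho> i) \<in> hom C (Dom C (snd (\<rho> i))) (FOb T (fst (\<rho> i)))"
    and e: "snd e = Comp C (FAr T m) (snd (\<rho> i))"
    using st by (metis el_stepD prod.collapse)
  obtain \<mu> where \<mu>: "\<And>l. l < N \<Longrightarrow> \<mu> l \<in> hom J (fst ((\<rho>(i := e)) l)) (fst A)"
      "\<And>l. l < N \<Longrightarrow> snd A l = Comp C (FAr T (\<mu> l)) (snd ((\<rho>(i := e)) l))"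
    and k: "fst A \<in> Obj J"
    using A unfolding merges_def by blast
  have \<mu>i: "\<mu> i \<in> hom J (fst e) (fst A)"
    using \<mu>(1)[OF i] by simp
  have "snd A i = Comp C (FAr T (Comp J (\<mu> i) m)) (snd (\<rho> i))"
    using \<mu>(2)[OF i] T.Comp_assoc[OF \<rho>i FAr_hom[OF m] FAr_hom[OF \<mu>i]] FAr_Comp[OF m \<mu>i] e
    by simp
  then have "\<forall>l<N. (\<mu>(i := Comp J (\<mu> i) m)) l \<in> hom J (fst (\<rho> l)) (fst A) \<and>
     snd A l = Comp C (FAr T ((\<mu>(i := Comp J (\<mu> i) m)) l)) (snd (\<rho> l))"
    using \<mu> S.Comp_hom[OF m \<mu>i] by (metis fun_upd_apply)
  with k show ?thesis unfolding merges_def by blast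
qed

text \<open>
  Induction along the zigzag in one entry. By \<open>merges_el_step\<close>, the families of the target of a step are
  families of its source as well. So after a forward step there is nothing to link, and after a
  backward step any family of the old representatives serves as a link to the new ones.
\<close>

lemma merges_el_eq_one:
  assumes \<rho>: "rep_family N d \<rho>" and i: "i < N" and e: "el_eq (\<rho> i) e"
    and A: "merges N \<rho> A" and B: "merges N (\<rho>(i := e)) B"
  shows "fam_eq N A B"
  using e B
proof (induction arbitrary: B rule: equivclp_induct)
  case base
  with merges_fam_eq[OF \<rho> A] show ?case by simp
next
  case (step y z)
  have fam: "rep_family N d (\<rho>(i := x))" if "el_eq (\<rho> i) x" for x
    using \<rho> i el_eq_hom[of "fst (\<rho> i)" "snd (\<rho> i)" "fst x" "snd x" "d i"] that
    by (auto simp: rep_family_def)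
  from step(2) show ?case
  proof
    assume "el_step y z"
    then have "merges N (\<rho>(i := y)) B"
      using merges_el_step[of "\<rho>(i := y)" i z N B] i step(4) by simp
    with step(3) show ?case .
  next
    assume st: "el_step z y"
    obtain B' where B': "merges N (\<rho>(i := y)) B'"
      using ex_merges[OF fam[OF step(1)]] .
    then have "merges N (\<rho>(i := z)) B'"
      using merges_el_step[of "\<rho>(i := z)" i y N B'] i st by simp
    moreover have "el_eq (\<rho> i) z"
      using step(1) st by (meson equivclp_sym equivclp_trans r_into_equivclp)
    ultimately have "fam_eq N B' B"
      using merges_fam_eq[OF fam] step(4) by blast
    with step(3)[OF B'] show ?case by (rule equivclp_trans)
  qed
qed

text \<open>
  The entries are exchanged one at a time. Every intermediate \<open>\<sigma> n\<close> merges into some family, which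
  links the consecutive exchanges.
\<close>

lemma merges_el_eq:
  assumes \<rho>: "rep_family N d \<rho>" and eq: "\<And>i. i < N \<Longrightarrow> el_eq (\<rho> i) (\<rho>' i)"
    and A: "merges N \<rho> A" and B: "merges N \<rho>' B"
  shows "fam_eq N A B"
proof -
  define \<sigma> where "\<sigma> n = (\<lambda>i. if i < n then \<rho>' i else \<rho> i)" for n
  have \<rho>': "fst (\<rho>' i) \<in> Obj J \<and> snd (\<rho>' i) \<in> hom C (d i) (FOb T (fst (\<rho>' i)))" if "i < N" for i
    using el_eq_hom[of "fst (\<rho> i)" "snd (\<rho> i)" "fst (\<rho>' i)" "snd (\<rho>' i)" "d i"]
      \<rho> eq[OF that] that by (auto simp: rep_family_def)
  have fam: "rep_family N d (\<sigma> n)" for n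
    using \<rho> \<rho>' by (auto simp: rep_family_def \<sigma>_def)
  have "fam_eq N A B'" if "n \<le> N" "merges N (\<sigma> n) B'" for n B'
    using that
  proof (induction n arbitrary: B')
    case 0
    then show ?case using merges_fam_eq[OF \<rho> A] by (simp add: \<sigma>_def)
  next
    case (Suc n)
    obtain A' where A': "merges N (\<sigma> n) A'"
      using ex_merges[OF fam] .
    have "\<sigma> (Suc n) = (\<sigma> n)(n := \<rho>' n)"
      by (auto simp: \<sigma>_def)
    moreover have "el_eq (\<sigma> n n) (\<rho>' n)"
      using eq Suc.prems by (simp add: \<sigma>_def)
    ultimately have "fam_eq N A' B'"
      using merges_el_eq_one[OF fam[of n], of n "\<rho>' n" A' B'] A' Suc.prems
      by (metis Suc_le_eq)
    with Suc.IH[OF _ A'] Suc.prems show ?case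
      by (meson Suc_leD equivclp_trans)
  qed
  moreover have "merges N (\<sigma> N) B"
    using B unfolding merges_def \<sigma>_def by auto
  ultimately show ?thesis by blast
qed

text \<open>
  This is the form in which siftedness enters the construction: finite products commute with sifted
  colimits of sets, so tuples of elements that agree in each entry are connected by one zigzag.
\<close>

lemma fam_eq_if_el_eq:
  assumes "z \<in> Obj J" and "z' \<in> Obj J"
    and \<kappa>: "\<And>i. i < N \<Longrightarrow> \<kappa> i \<in> hom C (d i) (FOb T z)"
    and eq: "\<And>i. i < N \<Longrightarrow> el_eq (z, \<kappa> i) (z', \<kappa>' i)"
  shows "fam_eq N (z, \<kappa>) (z', \<kappa>')"
proof (rule merges_el_eq[of N d "\<lambda>i. (z, \<kappa> i)" "\<lambda>i. (z', \<kappa>' i)"])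
  have \<kappa>': "\<kappa>' i \<in> hom C (d i) (FOb T z')" if "i < N" for i
    using el_eq_hom[OF eq[OF that] assms(1) \<kappa>[OF that]] by simp
  show "rep_family N d (\<lambda>i. (z, \<kappa> i))"
    using assms by (simp add: rep_family_def)
  show "merges N (\<lambda>i. (z, \<kappa> i)) (z, \<kappa>)"
    using assms(1) S.Id_hom FAr_Id T.Id_left[OF \<kappa>]
    by (auto simp: merges_def intro!: exI[of _ "\<lambda>_. Id J z"])
  show "merges N (\<lambda>i. (z', \<kappa>' i)) (z', \<kappa>')"
    using assms(2) S.Id_hom FAr_Id T.Id_left[OF \<kappa>']
    by (auto simp: merges_def intro!: exI[of _ "\<lambda>_. Id J z'"])
qed (use eq in auto)

end

section \<open>Identifying elements by a reflexive pair\<close>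

locale sifted_quotients = sifted_diagram J C T
  for J :: "('j, 'i) cat" and C :: "('o, 'a) cat" and T :: "('j, 'i, 'o, 'a) functr" +
  assumes pullbacks: "has_pullbacks C"
    and coequalizers: "has_reflexive_coequalizers C"
begin

lemma ex_pullback:
  assumes "f \<in> hom C x z" and "g \<in> hom C y z"
  obtains w p q where "p \<in> hom C w x" "q \<in> hom C w y" "Comp C f p = Comp C g q"
    "\<And>v a b. \<lbrakk>a \<in> hom C v x; b \<in> hom C v y; Comp C f a = Comp C g b\<rbrakk>
      \<Longrightarrow> \<exists>h\<in>hom C v w. Comp C p h = a \<and> Comp C q h = b"
proof -
  obtain w p q where "is_pullback C x y f g w p q"
    using pullbacks assms T.hom_Obj[OF assms(1)] T.hom_Obj[OF assms(2)]
    unfolding has_pullbacks_def by blast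
  then show thesis
    using that[of p w q] T.hom_Obj unfolding is_pullback_def by blast
qed

text \<open>
  The pair \<open>p, q\<close> is the composite of the kernel pair of \<open>u\<close> with that of \<open>v\<close>: its generalized elements
  are the triples \<open>(f, h, g)\<close> with \<open>u f = u h\<close> and \<open>v h = v g\<close>. The diagonal triples provide the common
  section. Since \<open>u\<close> and \<open>v\<close> represent the same element, composing with it does not distinguish \<open>p\<close>
  from \<open>q\<close>.
\<close>

lemma equalized_by_reflexive_pair:
  assumes u: "u \<in> hom C P x" and v: "v \<in> hom C P y"
    and j: "j \<in> Obj J" "x = FOb T j" and j': "y = FOb T j'" and uv: "el_eq (j, u) (j', v)"
  obtains R p q where "reflexive_pair C R P p q" "el_eq (j, Comp C u p) (j, Comp C u q)"
    "\<And>X f g h. \<lbrakk>f \<in> hom C X P; h \<in> hom C X P; g \<in> hom C X P; Comp C u f = Comp C u h;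
      Comp C v h = Comp C v g\<rbrakk> \<Longrightarrow> \<exists>\<rho>\<in>hom C X R. Comp C p \<rho> = f \<and> Comp C q \<rho> = g"
proof -
  obtain K k1 k2 where k: "k1 \<in> hom C K P" "k2 \<in> hom C K P" "Comp C u k1 = Comp C u k2"
    and K: "\<And>X a b. \<lbrakk>a \<in> hom C X P; b \<in> hom C X P; Comp C u a = Comp C u b\<rbrakk>
      \<Longrightarrow> \<exists>h\<in>hom C X K. Comp C k1 h = a \<and> Comp C k2 h = b"
    using ex_pullback[OF u u] by metis
  obtain L l1 l2 where l: "l1 \<in> hom C L P" "l2 \<in> hom C L P" "Comp C v l1 = Comp C v l2"
    and L: "\<And>X a b. \<lbrakk>a \<in> hom C X P; b \<in> hom C X P; Comp C v a = Comp C v b\<rbrakk>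
      \<Longrightarrow> \<exists>h\<in>hom C X L. Comp C l1 h = a \<and> Comp C l2 h = b"
    using ex_pullback[OF v v] by metis
  obtain R r1 r2 where r: "r1 \<in> hom C R K" "r2 \<in> hom C R L" "Comp C k2 r1 = Comp C l1 r2"
    and R: "\<And>X a b. \<lbrakk>a \<in> hom C X K; b \<in> hom C X L; Comp C k2 a = Comp C l1 b\<rbrakk>
      \<Longrightarrow> \<exists>h\<in>hom C X R. Comp C r1 h = a \<and> Comp C r2 h = b"
    using ex_pullback[OF k(2) l(1)] by metis
  define p q where "p = Comp C k1 r1" and "q = Comp C l2 r2"
  have p: "p \<in> hom C R P" and q: "q \<in> hom C R P"
    unfolding p_def q_def using T.Comp_hom k l r by blast+
  have med: "\<exists>\<rho>\<in>hom C X R. Comp C p \<rho> = f \<and> Comp C q \<rho> = g"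
    if fgh: "f \<in> hom C X P" "h \<in> hom C X P" "g \<in> hom C X P" "Comp C u f = Comp C u h"
      "Comp C v h = Comp C v g" for X f g h
  proof -
    obtain a b where a: "a \<in> hom C X K" "Comp C k1 a = f" "Comp C k2 a = h"
      and b: "b \<in> hom C X L" "Comp C l1 b = h" "Comp C l2 b = g"
      using K[OF fgh(1,2,4)] L[OF fgh(2,3,5)] by blast
    then obtain \<rho> where \<rho>: "\<rho> \<in> hom C X R" "Comp C r1 \<rho> = a" "Comp C r2 \<rho> = b"
      using R[of a X b] by auto
    then show ?thesis
      using a b T.Comp_assoc[OF \<rho>(1) r(1) k(1)] T.Comp_assoc[OF \<rho>(1) r(2) l(2)]
      by (auto simp: p_def q_def)
  qed
  have P: "P \<in> Obj C"
    using T.hom_Obj u by blast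
  have one: "Id C P \<in> hom C P P"
    using T.Id_hom P by blast
  have refl: "reflexive_pair C R P p q"
    using p q P T.hom_Obj[OF p] med[OF one one one] by (auto simp: reflexive_pair_def)
  have "el_eq (j, Comp C u p) (j', Comp C v (Comp C k2 r1))"
    using el_eq_precomp[OF uv, OF u[unfolded j(2)] T.Comp_hom[OF r(1) k(2)]]
      T.Comp_assoc[OF r(1) k(1) u] T.Comp_assoc[OF r(1) k(2) u] k(3) by (simp add: p_def)
  moreover have "Comp C v (Comp C k2 r1) = Comp C v q"
    using T.Comp_assoc[OF r(2) l(1) v] T.Comp_assoc[OF r(2) l(2) v] l(3) r(3) by (simp add: q_def)
  moreover have "el_eq (j, Comp C u q) (j', Comp C v q)"
    using el_eq_precomp[OF uv, OF u[unfolded j(2)] q] .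
  ultimately have "el_eq (j, Comp C u p) (j, Comp C u q)"
    by (metis equivclp_sym equivclp_trans)
  with refl show thesis
    by (rule that) (rule med)
qed

text \<open>
  The object \<open>P\<close> is the limit of the zigzag, and a pullback is formed at each backward step. The
  families factor through \<open>P\<close> because every step moves all entries simultaneously.
\<close>

lemma zigzag_limit:
  assumes "fam_eq N (z, \<kappa>) B" and z: "z \<in> Obj J"
    and \<kappa>: "\<And>i. i < N \<Longrightarrow> \<kappa> i \<in> hom C (d i) (FOb T z)"
  shows "\<exists>P u v w. u \<in> hom C P (FOb T z) \<and> v \<in> hom C P (FOb T (fst B)) \<and>
     el_eq (z, u) (fst B, v) \<and>
     (\<forall>i<N. w i \<in> hom C (d i) P \<and> Comp C u (w i) = \<kappa> i \<and> Comp C v (w i) = snd B i)"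
  using assms(1)
proof (induction rule: equivclp_induct)
  case base
  have "Id C (FOb T z) \<in> hom C (FOb T z) (FOb T z)"
    using T.Id_hom FOb_Obj[OF z] by blast
  then show ?case
    using \<kappa> T.Id_left[OF \<kappa>] 
    by (intro exI[of _ "FOb T z"] exI[of _ "Id C (FOb T z)"] exI[of _ \<kappa>]) auto
next
  case (step B B')
  then obtain P u v w where u: "u \<in> hom C P (FOb T z)" and v: "v \<in> hom C P (FOb T (fst B))"
    and uv: "el_eq (z, u) (fst B, v)" and w: "\<And>i. i < N \<Longrightarrow> w i \<in> hom C (d i) P"
    "\<And>i. i < N \<Longrightarrow> Comp C u (w i) = \<kappa> i" "\<And>i. i < N \<Longrightarrow> Comp C v (w i) = snd B i"
    by blast
  from step(2) show ?case
  proof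
    assume "fam_step N B B'"
    then obtain m where m: "m \<in> hom J (fst B) (fst B')"
      and B': "\<And>i. i < N \<Longrightarrow> snd B' i = Comp C (FAr T m) (snd B i)"
      by (auto simp: fam_step_def)
    have "el_eq (z, u) (fst B', Comp C (FAr T m) v)"
      using uv el_eq_map[OF m v] by (rule equivclp_trans)
    moreover have "Comp C (Comp C (FAr T m) v) (w i) = snd B' i" if "i < N" for i
      using T.Comp_assoc[OF w(1)[OF that] v FAr_hom[OF m]] w(3)[OF that] B'[OF that] by simp
    ultimately show ?thesis
      using u w T.Comp_hom[OF v FAr_hom[OF m]] by blast
  next
    assume "fam_step N B' B"
    then obtain m where m: "m \<in> hom J (fst B') (fst B)"
      and B': "\<And>i. i < N \<Longrightarrow> snd B' i \<in> hom C (Dom C (snd B' i)) (FOb T (fst B'))"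
      and B: "\<And>i. i < N \<Longrightarrow> snd B i = Comp C (FAr T m) (snd B' i)"
      by (auto simp: fam_step_def hom_def)
    obtain P' p q where p: "p \<in> hom C P' P" and q: "q \<in> hom C P' (FOb T (fst B'))"
      and pq: "Comp C v p = Comp C (FAr T m) q"
      and med: "\<And>X a b. \<lbrakk>a \<in> hom C X P; b \<in> hom C X (FOb T (fst B'));
        Comp C v a = Comp C (FAr T m) b\<rbrakk> \<Longrightarrow> \<exists>h\<in>hom C X P'. Comp C p h = a \<and> Comp C q h = b"
      using ex_pullback[OF v FAr_hom[OF m]] by metis
    have "\<exists>h\<in>hom C (d i) P'. Comp C p h = w i \<and> Comp C q h = snd B' i" if "i < N" for i
    proof -
      have "Dom C (snd B' i) = d i"
        using T.Comp_hom[OF w(1)[OF that] v] T.Comp_hom[OF B'[OF that] FAr_hom[OF m]]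
          w(3)[OF that] B[OF that] by (simp add: hom_def)
      with med[OF w(1)[OF that], of "snd B' i"] B'[OF that] w(3)[OF that] B[OF that]
      show ?thesis by simp
    qed
    then obtain w' where w': "\<And>i. i < N \<Longrightarrow> w' i \<in> hom C (d i) P'"
      "\<And>i. i < N \<Longrightarrow> Comp C p (w' i) = w i" "\<And>i. i < N \<Longrightarrow> Comp C q (w' i) = snd B' i"
      by metis
    have "el_eq (z, Comp C u p) (fst B, Comp C (FAr T m) q)"
      using el_eq_precomp[OF uv u p] pq by simp
    also have "el_eq \<dots> (fst B', q)"
      using el_eq_map[OF m q] by (rule equivclp_sym)
    finally have "el_eq (z, Comp C u p) (fst B', q)" .
    moreover have "Comp C (Comp C u p) (w' i) = \<kappa> i" if "i < N" for i
      using T.Comp_assoc[OF w'(1)[OF that] p u] w'(2)[OF that] w(2)[OF that] by simp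
    ultimately show ?thesis
      using q w' T.Comp_hom[OF p u] by blast
  qed
qed

text \<open>
  Two families are compared, \<open>(a, a f i)\<close> and \<open>(a, a g i)\<close>. Including \<open>a\<close> itself yields the arrow \<open>s\<close>, which
  lifts \<open>a\<close> along both ends \<open>u\<close> and \<open>v\<close> of the limit of the zigzag. The other entries yield arrows into
  \<open>P\<close> that agree with \<open>s f i\<close> under \<open>u\<close> and with \<open>s g i\<close> under \<open>v\<close>, so that the composite of the two
  kernel pairs identifies \<open>s f i\<close> with \<open>s g i\<close>.
\<close>

lemma reflexive_pair_identifying:
  fixes n :: nat
  assumes j: "j \<in> Obj J" and a: "a \<in> hom C x (FOb T j)"
    and f: "\<And>i. i < n \<Longrightarrow> f i \<in> hom C (c i) x" and g: "\<And>i. i < n \<Longrightarrow> g i \<in> hom C (c i) x"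
    and eq: "\<And>i. i < n \<Longrightarrow> el_eq (j, Comp C a (f i)) (j, Comp C a (g i))"
  obtains P u s R p q where "u \<in> hom C P (FOb T j)" "s \<in> hom C x P" "Comp C u s = a"
    "reflexive_pair C R P p q" "el_eq (j, Comp C u p) (j, Comp C u q)"
    "\<And>z e i. \<lbrakk>e \<in> hom C P z; Comp C e p = Comp C e q; i < n\<rbrakk>
      \<Longrightarrow> Comp C (Comp C e s) (f i) = Comp C (Comp C e s) (g i)"
proof -
  define d where "d = case_nat x c"
  define \<kappa> where "\<kappa> = case_nat a (\<lambda>i. Comp C a (f i))"
  define \<kappa>' where "\<kappa>' = case_nat a (\<lambda>i. Comp C a (g i))"
  have \<kappa>: "\<kappa> i \<in> hom C (d i) (FOb T j)" if "i < Suc n" for i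
    using that a T.Comp_hom[OF f a] by (auto simp: \<kappa>_def d_def split: nat.split)
  have \<kappa>\<kappa>': "el_eq (j, \<kappa> i) (j, \<kappa>' i)" if "i < Suc n" for i
    using that eq by (auto simp: \<kappa>_def \<kappa>'_def split: nat.split)
  have "fam_eq (Suc n) (j, \<kappa>) (j, \<kappa>')"
    using fam_eq_if_el_eq[OF j j \<kappa> \<kappa>\<kappa>'] .
  then obtain P u v w where u: "u \<in> hom C P (FOb T j)" and v: "v \<in> hom C P (FOb T j)"
    and uv: "el_eq (j, u) (j, v)" and w_all: "\<forall>i<Suc n. w i \<in> hom C (d i) P \<and>
      Comp C u (w i) = \<kappa> i \<and> Comp C v (w i) = \<kappa>' i"
    using zigzag_limit[of "Suc n" j \<kappa> "(j, \<kappa>')" d] j \<kappa> by auto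
  have w: "w i \<in> hom C (d i) P" "Comp C u (w i) = \<kappa> i" "Comp C v (w i) = \<kappa>' i" if "i < Suc n" for i
    using w_all that by auto
  define s where "s = w 0"
  have s: "s \<in> hom C x P" "Comp C u s = a" "Comp C v s = a"
    using w[of 0] by (auto simp: s_def d_def \<kappa>_def \<kappa>'_def)
  obtain R p q where R: "reflexive_pair C R P p q" "el_eq (j, Comp C u p) (j, Comp C u q)"
    and med: "\<And>X f g h. \<lbrakk>f \<in> hom C X P; h \<in> hom C X P; g \<in> hom C X P; Comp C u f = Comp C u h;
      Comp C v h = Comp C v g\<rbrakk> \<Longrightarrow> \<exists>\<rho>\<in>hom C X R. Comp C p \<rho> = f \<and> Comp C q \<rho> = g"
    using equalized_by_reflexive_pair[OF u v j refl refl uv] by metis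
  have pq: "p \<in> hom C R P" "q \<in> hom C R P"
    using R(1) by (auto simp: reflexive_pair_def)
  have "Comp C (Comp C e s) (f i) = Comp C (Comp C e s) (g i)"
    if e: "e \<in> hom C P z" "Comp C e p = Comp C e q" and i: "i < n" for e z i
  proof -
    have k: "w (Suc i) \<in> hom C (c i) P" "Comp C u (w (Suc i)) = Comp C a (f i)"
      "Comp C v (w (Suc i)) = Comp C a (g i)"
      using w[of "Suc i"] i by (auto simp: d_def \<kappa>_def \<kappa>'_def)
    obtain \<rho> where \<rho>: "\<rho> \<in> hom C (c i) R" "Comp C p \<rho> = Comp C s (f i)"
      "Comp C q \<rho> = Comp C s (g i)"
      using med[OF T.Comp_hom[OF f[OF i] s(1)] k(1) T.Comp_hom[OF g[OF i] s(1)]]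
        T.Comp_assoc[OF f[OF i] s(1) u] T.Comp_assoc[OF g[OF i] s(1) v] s k by auto
    show ?thesis
      using T.Comp_assoc[OF f[OF i] s(1) e(1)] T.Comp_assoc[OF g[OF i] s(1) e(1)]
        T.Comp_assoc[OF \<rho>(1) pq(1) e(1)] T.Comp_assoc[OF \<rho>(1) pq(2) e(1)] \<rho> e(2) by simp
  qed
  from that[OF u s(1,2) R this] show thesis .
qed

section \<open>The filtered category of quotients\<close>

text \<open>
  A reflexive coequalizer \<open>e\<close> whose domain carries an element \<open>(j, f)\<close>. As \<open>p\<close>
  and \<open>q\<close> do not differ on this element, any cocone on \<open>T\<close> induces an arrow out of the codomain of \<open>e\<close>.
\<close>

definition is_quot :: "'j \<Rightarrow> 'a \<Rightarrow> 'a \<Rightarrow> bool" where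
  "is_quot j f e \<longleftrightarrow> j \<in> Obj J \<and> f \<in> hom C (Dom C e) (FOb T j) \<and>
     (\<exists>R p q. reflexive_pair C R (Dom C e) p q \<and> el_eq (j, Comp C f p) (j, Comp C f q) \<and>
        is_coequalizer C (Dom C e) p q (Cod C e) e)"

text \<open>
  Arrows between the vertices of the coequalizers that lift to arrows of elements. The lift \<open>s\<close> is
  not part of an arrow, because different lifts may induce the same arrow of vertices.
\<close>

definition quot_cat :: "('j \<times> 'a \<times> 'a, ('j \<times> 'a \<times> 'a) \<times> 'a \<times> ('j \<times> 'a \<times> 'a)) cat" where
  "quot_cat = \<lparr>Obj = {(j, f, e). is_quot j f e},
     Arr = {((j, f, e), h, (j', f', e')) | j f e h j' f' e'. is_quot j f e \<and> is_quot j' f' e' \<and>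
       h \<in> hom C (Cod C e) (Cod C e') \<and> (\<exists>s\<in>hom C (Dom C e) (Dom C e').
         Comp C e' s = Comp C h e \<and> el_eq (j, f) (j', Comp C f' s))},
     Dom = (\<lambda>(a, h, b). a),
     Cod = (\<lambda>(a, h, b). b),
     Id = (\<lambda>(j, f, e). ((j, f, e), Id C (Cod C e), (j, f, e))),
     Comp = (\<lambda>(b, k, c) (a, h, b'). (a, Comp C k h, c))\<rparr>"

definition quot_proj ::
  "('j \<times> 'a \<times> 'a, ('j \<times> 'a \<times> 'a) \<times> 'a \<times> ('j \<times> 'a \<times> 'a), 'o, 'a) functr" where
  "quot_proj = \<lparr>FOb = (\<lambda>(j, f, e). Cod C e), FAr = (\<lambda>(a, h, b). h)\<rparr>"

lemma is_quotI:
  assumes "j \<in> Obj J" and "f \<in> hom C y (FOb T j)" and "reflexive_pair C R y p q"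
    and "el_eq (j, Comp C f p) (j, Comp C f q)" and "is_coequalizer C y p q z e"
  shows "is_quot j f e"
proof -
  have "Dom C e = y" "Cod C e = z"
    using assms(5) by (auto simp: is_coequalizer_def hom_def)
  with assms show ?thesis by (auto simp: is_quot_def)
qed

lemma is_quotE:
  assumes "is_quot j f e"
  obtains y z R p q where "j \<in> Obj J" "Dom C e = y" "Cod C e = z" "e \<in> hom C y z"
    "f \<in> hom C y (FOb T j)" "reflexive_pair C R y p q" "p \<in> hom C R y" "q \<in> hom C R y"
    "el_eq (j, Comp C f p) (j, Comp C f q)" "is_coequalizer C y p q z e"
proof -
  from assms obtain R p q where *: "j \<in> Obj J" "f \<in> hom C (Dom C e) (FOb T j)"
    "reflexive_pair C R (Dom C e) p q" "el_eq (j, Comp C f p) (j, Comp C f q)"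
    "is_coequalizer C (Dom C e) p q (Cod C e) e"
    by (auto simp: is_quot_def)
  moreover from *(3) have "p \<in> hom C R (Dom C e)" "q \<in> hom C R (Dom C e)"
    by (auto simp: reflexive_pair_def)
  moreover from *(5) have "e \<in> hom C (Dom C e) (Cod C e)"
    by (simp add: is_coequalizer_def)
  ultimately show thesis by (intro that[of "Dom C e" "Cod C e" R p q]) auto
qed

lemma is_quot_Id:
  assumes "j \<in> Obj J" and "f \<in> hom C y (FOb T j)"
  shows "is_quot j f (Id C y)"
  using assms T.hom_Obj(1)[OF assms(2)]
  by (intro is_quotI[OF assms T.reflexive_pair_Id _ T.is_coequalizer_Id]) auto

lemma quot_cat_homI:
  assumes "is_quot j f e" and "is_quot j' f' e'" and "e \<in> hom C y z" and "e' \<in> hom C y' z'"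
    and "h \<in> hom C z z'" and "s \<in> hom C y y'" and "Comp C e' s = Comp C h e"
    and "el_eq (j, f) (j', Comp C f' s)"
  shows "((j, f, e), h, (j', f', e')) \<in> hom quot_cat (j, f, e) (j', f', e')"
  using assms T.hom_Arr[OF assms(3)] T.hom_Arr[OF assms(4)]
  unfolding hom_def[of quot_cat] by (auto simp: quot_cat_def)

lemma quot_cat_homE:
  assumes "g \<in> hom quot_cat a b"
  obtains j f e j' f' e' y y' z z' h s where "a = (j, f, e)" "b = (j', f', e')" "g = (a, h, b)"
    "is_quot j f e" "is_quot j' f' e'" "e \<in> hom C y z" "e' \<in> hom C y' z'"
    "h \<in> hom C z z'" "s \<in> hom C y y'" "Comp C e' s = Comp C h e" "el_eq (j, f) (j', Comp C f' s)"
proof -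
  from assms obtain j f e j' f' e' h s where *: "a = (j, f, e)" "b = (j', f', e')" "g = (a, h, b)"
    "is_quot j f e" "is_quot j' f' e'" "h \<in> hom C (Cod C e) (Cod C e')"
    "s \<in> hom C (Dom C e) (Dom C e')" "Comp C e' s = Comp C h e" "el_eq (j, f) (j', Comp C f' s)"
    unfolding hom_def[of quot_cat] by (auto simp: quot_cat_def)
  have "e \<in> hom C (Dom C e) (Cod C e)" "e' \<in> hom C (Dom C e') (Cod C e')"
    using *(4,5) by (auto elim: is_quotE)
  with * show thesis by (intro that)
qed

lemma quot_cat_hom_proj:
  assumes "g \<in> hom quot_cat a b"
  obtains h where "g = (a, h, b)" "h \<in> hom C (FOb quot_proj a) (FOb quot_proj b)"
  using assms unfolding hom_def[of quot_cat] by (auto simp: quot_cat_def quot_proj_def)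

lemma category_quot_cat: "category quot_cat"
proof
  fix g
  assume "g \<in> Arr quot_cat"
  then show "Dom quot_cat g \<in> Obj quot_cat" "Cod quot_cat g \<in> Obj quot_cat"
    by (auto simp: quot_cat_def)
next
  fix a
  assume "a \<in> Obj quot_cat"
  then obtain j f e where a: "a = (j, f, e)" and q: "is_quot j f e"
    by (auto simp: quot_cat_def)
  from q obtain y z where e: "e \<in> hom C y z" "Cod C e = z" and f: "f \<in> hom C y (FOb T j)"
    by (elim is_quotE) blast
  note one = T.Id_hom[OF T.hom_Obj(1)[OF e(1)]] T.Id_hom[OF T.hom_Obj(2)[OF e(1)]]
  have "((j, f, e), Id C z, (j, f, e)) \<in> hom quot_cat (j, f, e) (j, f, e)"
    by (rule quot_cat_homI[OF q q e(1) e(1) one(2,1)])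
      (use T.Id_left[OF e(1)] T.Id_right[OF e(1)] T.Id_right[OF f] in auto)
  then show "Id quot_cat a \<in> hom quot_cat a a"
    by (simp add: a quot_cat_def e(2))
next
  fix a b c g g'
  assume g: "g \<in> hom quot_cat a b" and g': "g' \<in> hom quot_cat b c"
  obtain j f e j' f' e' y y' z z' h s where a: "a = (j, f, e)" "g = (a, h, b)"
      "is_quot j f e" "is_quot j' f' e'" and b_eq: "b = (j', f', e')"
    and e: "e \<in> hom C y z" and e': "e' \<in> hom C y' z'"
    and h: "h \<in> hom C z z'" and s: "s \<in> hom C y y'" and es: "Comp C e' s = Comp C h e"
    and fs: "el_eq (j, f) (j', Comp C f' s)"
    using g by (rule quot_cat_homE)
  obtain k' l' m' x x' w w' n t where b: "c = (k', l', m')" "g' = (b, n, c)"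
      "is_quot k' l' m'" and x: "e' \<in> hom C x w" and m': "m' \<in> hom C x' w'"
    and n: "n \<in> hom C w w'" and t: "t \<in> hom C x x'" and mt: "Comp C m' t = Comp C n e'"
    and lt: "el_eq (j', f') (k', Comp C l' t)"
    using g' unfolding b_eq by (rule quot_cat_homE) blast
  have "x = y'" "w = z'"
    using x e' by (auto simp: hom_def)
  note t = t[unfolded \<open>x = y'\<close>] and n = n[unfolded \<open>w = z'\<close>]
  have f': "f' \<in> hom C y' (FOb T j')"
    using a(4) T.hom_Arr[OF e'] by (auto simp: is_quot_def)
  have l': "l' \<in> hom C x' (FOb T k')"
    using b(3) T.hom_Arr[OF m'] by (auto simp: is_quot_def)
  have "Comp C m' (Comp C t s) = Comp C (Comp C n h) e"
    using T.Comp_assoc[OF s t m'] T.Comp_assoc[OF s e' n] T.Comp_assoc[OF e h n] mt es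
    by simp
  moreover have "el_eq (j, f) (k', Comp C l' (Comp C t s))"
    using el_eq_precomp[OF lt f' s] T.Comp_assoc[OF s t l'] fs
    by (metis equivclp_trans)
  ultimately have "(a, Comp C n h, c) \<in> hom quot_cat a c"
    unfolding a(1) b(1)
    by (intro quot_cat_homI[OF a(3) b(3) e m' T.Comp_hom[OF h n] T.Comp_hom[OF s t]])
  then show "Comp quot_cat g' g \<in> hom quot_cat a c"
    by (simp add: a b quot_cat_def)
next
  fix a b g
  assume "g \<in> hom quot_cat a b"
  then obtain h where g: "g = (a, h, b)" and h: "h \<in> hom C (FOb quot_proj a) (FOb quot_proj b)"
    by (rule quot_cat_hom_proj)
  from T.Id_left[OF h] T.Id_right[OF h]
  show "Comp quot_cat (Id quot_cat b) g = g" "Comp quot_cat g (Id quot_cat a) = g"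
    by (simp_all add: g quot_cat_def quot_proj_def split: prod.splits)
next
  fix a b c d g1 g2 g3
  assume g: "g1 \<in> hom quot_cat a b" "g2 \<in> hom quot_cat b c" "g3 \<in> hom quot_cat c d"
  obtain h1 where h1: "g1 = (a, h1, b)" "h1 \<in> hom C (FOb quot_proj a) (FOb quot_proj b)"
    using g(1) by (rule quot_cat_hom_proj)
  obtain h2 where h2: "g2 = (b, h2, c)" "h2 \<in> hom C (FOb quot_proj b) (FOb quot_proj c)"
    using g(2) by (rule quot_cat_hom_proj)
  obtain h3 where h3: "g3 = (c, h3, d)" "h3 \<in> hom C (FOb quot_proj c) (FOb quot_proj d)"
    using g(3) by (rule quot_cat_hom_proj)
  show "Comp quot_cat g3 (Comp quot_cat g2 g1) = Comp quot_cat (Comp quot_cat g3 g2) g1"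
    using T.Comp_assoc[OF h1(2) h2(2) h3(2)] by (simp add: quot_cat_def h1 h2 h3)
qed

text \<open>
  Two pairs at a time are enough for filteredness: an upper bound has to respect two relations, and
  coequalizing two arrows has to respect the relation of their codomain and to identify their lifts.
\<close>

lemma ex_quot_identifying:
  assumes j: "j \<in> Obj J" and a: "a \<in> hom C x (FOb T j)"
    and "f1 \<in> hom C c1 x" "g1 \<in> hom C c1 x" "f2 \<in> hom C c2 x" "g2 \<in> hom C c2 x"
    and "el_eq (j, Comp C a f1) (j, Comp C a g1)" "el_eq (j, Comp C a f2) (j, Comp C a g2)"
  obtains P z u s e where "is_quot j u e" "u \<in> hom C P (FOb T j)" "e \<in> hom C P z"
    "s \<in> hom C x P" "Comp C u s = a"
    "Comp C (Comp C e s) f1 = Comp C (Comp C e s) g1"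
    "Comp C (Comp C e s) f2 = Comp C (Comp C e s) g2"
proof -
  define f where "f i = (if i = 0 then f1 else f2)" for i :: nat
  define g where "g i = (if i = 0 then g1 else g2)" for i :: nat
  define c where "c i = (if i = 0 then c1 else c2)" for i :: nat
  obtain P u s R p q where u: "u \<in> hom C P (FOb T j)" and s: "s \<in> hom C x P" "Comp C u s = a"
    and R: "reflexive_pair C R P p q" and pq: "el_eq (j, Comp C u p) (j, Comp C u q)"
    and ident: "\<And>z e i. \<lbrakk>e \<in> hom C P z; Comp C e p = Comp C e q; i < 2\<rbrakk>
      \<Longrightarrow> Comp C (Comp C e s) (f i) = Comp C (Comp C e s) (g i)"
    by (rule reflexive_pair_identifying[OF j a, of 2 f c g])
      (use assms(3-) in \<open>auto simp: f_def g_def c_def\<close>)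
  obtain z e where ze: "is_coequalizer C P p q z e"
    using coequalizers R unfolding has_reflexive_coequalizers_def by blast
  then have e: "e \<in> hom C P z" "Comp C e p = Comp C e q"
    by (auto simp: is_coequalizer_def)
  from is_quotI[OF j u R pq ze] u e(1) s ident[OF e, of 0] ident[OF e, of 1] show thesis
    by (intro that) (auto simp: f_def g_def)
qed

text \<open>
  A cocone in \<open>J\<close> sends both elements to one object \<open>x = T k\<close>. The images in \<open>x\<close> of the two reflexive
  pairs are equal as elements, so some quotient of an object under \<open>x\<close> identifies each of them, and both
  coequalizers map to it.
\<close>

lemma quot_cat_upper_bound:
  assumes "is_quot j f e" and "is_quot j' f' e'"
  obtains c g g' where "g \<in> hom quot_cat (j, f, e) c" "g' \<in> hom quot_cat (j', f', e') c"
proof -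
  obtain y z R p q where q1: "j \<in> Obj J" "e \<in> hom C y z" "f \<in> hom C y (FOb T j)"
    "p \<in> hom C R y" "q \<in> hom C R y"
    "el_eq (j, Comp C f p) (j, Comp C f q)" "is_coequalizer C y p q z e"
    using assms(1) by (rule is_quotE) blast
  obtain y' z' R' p' q' where q2: "j' \<in> Obj J" "e' \<in> hom C y' z'" "f' \<in> hom C y' (FOb T j')"
    "p' \<in> hom C R' y'" "q' \<in> hom C R' y'"
    "el_eq (j', Comp C f' p') (j', Comp C f' q')" "is_coequalizer C y' p' q' z' e'"
    using assms(2) by (rule is_quotE) blast
  obtain k \<mu> where k: "k \<in> Obj J"
    and \<mu>: "\<And>i::nat. i < 2 \<Longrightarrow> \<mu> i \<in> hom J (if i = 0 then j else j') k"
  proof (rule ex_cocone[of 2 "\<lambda>i. if i = 0 then j else j'"])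
    show "(if i = 0 then j else j') \<in> Obj J" for i :: nat
      using q1(1) q2(1) by simp
  qed (rule that)
  have m: "\<mu> 0 \<in> hom J j k" "\<mu> 1 \<in> hom J j' k"
    using \<mu>[of 0] \<mu>[of 1] by auto
  define x where "x = FOb T k"
  have x: "Id C x \<in> hom C x x" "Id C x \<in> hom C x (FOb T k)"
    using T.Id_hom FOb_Obj[OF k] by (auto simp: x_def)
  define t where "t = Comp C (FAr T (\<mu> 0)) f"
  define t' where "t' = Comp C (FAr T (\<mu> 1)) f'"
  have t: "t \<in> hom C y x" "t' \<in> hom C y' x"
    unfolding t_def t'_def x_def by (rule T.Comp_hom[OF _ FAr_hom]; fact)+
  have ft: "el_eq (j, f) (k, t)" "el_eq (j', f') (k, t')"
    unfolding t_def t'_def by (rule el_eq_map; fact)+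
  have "el_eq (k, Comp C t p) (k, Comp C t q)"
    using el_eq_precomp[OF ft(1) q1(3) q1(4)] el_eq_precomp[OF ft(1) q1(3) q1(5)] q1(6)
    by (metis equivclp_sym equivclp_trans)
  then have eq1: "el_eq (k, Comp C (Id C x) (Comp C t p)) (k, Comp C (Id C x) (Comp C t q))"
    using T.Id_left[OF T.Comp_hom[OF q1(4) t(1)]] T.Id_left[OF T.Comp_hom[OF q1(5) t(1)]] by simp
  have "el_eq (k, Comp C t' p') (k, Comp C t' q')"
    using el_eq_precomp[OF ft(2) q2(3) q2(4)] el_eq_precomp[OF ft(2) q2(3) q2(5)] q2(6)
    by (metis equivclp_sym equivclp_trans)
  then have eq2: "el_eq (k, Comp C (Id C x) (Comp C t' p')) (k, Comp C (Id C x) (Comp C t' q'))"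
    using T.Id_left[OF T.Comp_hom[OF q2(4) t(2)]] T.Id_left[OF T.Comp_hom[OF q2(5) t(2)]] by simp
  obtain P w u s d where quot: "is_quot k u d" and u: "u \<in> hom C P (FOb T k)" and d: "d \<in> hom C P w"
    and s: "s \<in> hom C x P" and us: "Comp C u s = Id C x"
    and id1: "Comp C (Comp C d s) (Comp C t p) = Comp C (Comp C d s) (Comp C t q)"
    and id2: "Comp C (Comp C d s) (Comp C t' p') = Comp C (Comp C d s) (Comp C t' q')"
    using ex_quot_identifying[OF k x(2) T.Comp_hom[OF q1(4) t(1)] T.Comp_hom[OF q1(5) t(1)]
        T.Comp_hom[OF q2(4) t(2)] T.Comp_hom[OF q2(5) t(2)] eq1 eq2] .
  have ds: "Comp C d s \<in> hom C x w"
    using T.Comp_hom[OF s d] .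
  have *: "\<exists>g. g \<in> hom quot_cat (i, l, m) (k, u, d)"
    if q: "is_quot i l m" "m \<in> hom C a b" "is_coequalizer C a r r' b m"
      "r \<in> hom C A a" "r' \<in> hom C A a" and
      n: "n \<in> hom C a x" "el_eq (i, l) (k, n)"
        "Comp C (Comp C d s) (Comp C n r) = Comp C (Comp C d s) (Comp C n r')"
    for i l m a b A r r' n
  proof -
    have "Comp C (Comp C (Comp C d s) n) r = Comp C (Comp C (Comp C d s) n) r'"
      using T.Comp_assoc[OF q(4) n(1) ds] T.Comp_assoc[OF q(5) n(1) ds] n(3) by simp
    then obtain h where h: "h \<in> hom C b w" "Comp C h m = Comp C (Comp C d s) n"
      using T.coequalizer_factor[OF q(3) T.Comp_hom[OF n(1) ds]] by blast
    have "Comp C u (Comp C s n) = n"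
      using T.Comp_assoc[OF n(1) s u] us T.Id_left[OF n(1)] by simp
    then have "((i, l, m), h, (k, u, d)) \<in> hom quot_cat (i, l, m) (k, u, d)"
      using T.Comp_assoc[OF n(1) s d] h n(2)
      by (intro quot_cat_homI[OF q(1) quot q(2) d h(1) T.Comp_hom[OF n(1) s]]) simp_all
    then show ?thesis ..
  qed
  from *[OF assms(1) q1(2,7,4,5) t(1) ft(1) id1] *[OF assms(2) q2(2,7,4,5) t(2) ft(2) id2] that
  show thesis by blast
qed

text \<open>
  The lifts \<open>s1\<close> and \<open>s2\<close> represent the same element, hence they are identified together with the
  relation of the target \<open>b\<close>. Equality of the composites then follows since \<open>e\<close> is an epimorphism.
\<close>

lemma quot_cat_equalize:
  assumes "g1 \<in> hom quot_cat a b" and "g2 \<in> hom quot_cat a b"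
  obtains c g where "g \<in> hom quot_cat b c" "Comp quot_cat g g1 = Comp quot_cat g g2"
proof -
  obtain j f e j' f' e' y y' z z' h1 s1 where ab: "a = (j, f, e)" "b = (j', f', e')"
    and g1: "g1 = (a, h1, b)"
    and q: "is_quot j f e" "is_quot j' f' e'" and e: "e \<in> hom C y z" and e': "e' \<in> hom C y' z'"
    and h1: "h1 \<in> hom C z z'" and s1: "s1 \<in> hom C y y'" "Comp C e' s1 = Comp C h1 e"
      "el_eq (j, f) (j', Comp C f' s1)"
    using assms(1) by (rule quot_cat_homE)
  have dc: "Dom C e = y" "Cod C e = z" "Dom C e' = y'" "Cod C e' = z'"
    using e e' by (auto simp: hom_def)
  obtain h2 s2 where g2: "g2 = (a, h2, b)"
    and h2: "h2 \<in> hom C z z'" and s2: "s2 \<in> hom C y y'" "Comp C e' s2 = Comp C h2 e"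
      "el_eq (j, f) (j', Comp C f' s2)"
    using assms(2) unfolding ab hom_def[of quot_cat] by (auto simp: quot_cat_def dc)
  obtain R p q where R: "p \<in> hom C R y" "q \<in> hom C R y" "is_coequalizer C y p q z e"
    using q(1) dc by (elim is_quotE) blast
  obtain R' p' q' where j': "j' \<in> Obj J" and f': "f' \<in> hom C y' (FOb T j')"
    and R': "p' \<in> hom C R' y'" "q' \<in> hom C R' y'" "is_coequalizer C y' p' q' z' e'"
    and pq': "el_eq (j', Comp C f' p') (j', Comp C f' q')"
    using q(2) dc by (elim is_quotE) blast
  have "el_eq (j', Comp C f' s1) (j', Comp C f' s2)"
    using s1(3) s2(3) by (metis equivclp_sym equivclp_trans)
  then obtain P w u s d where quot: "is_quot j' u d" and u: "u \<in> hom C P (FOb T j')"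
    and d: "d \<in> hom C P w" and s: "s \<in> hom C y' P" and us: "Comp C u s = f'"
    and id1: "Comp C (Comp C d s) s1 = Comp C (Comp C d s) s2"
    and id2: "Comp C (Comp C d s) p' = Comp C (Comp C d s) q'"
    using ex_quot_identifying[OF j' f' s1(1) s2(1) R'(1,2) _ pq'] by metis
  obtain k where k: "k \<in> hom C z' w" "Comp C k e' = Comp C d s"
    using T.coequalizer_factor[OF R'(3) T.Comp_hom[OF s d] id2] .
  have "Comp C (Comp C k h1) e = Comp C (Comp C k h2) e"
    using T.Comp_assoc[OF e h1 k(1)] T.Comp_assoc[OF e h2 k(1)] s1(2) s2(2)
      T.Comp_assoc[OF s1(1) e' k(1)] T.Comp_assoc[OF s2(1) e' k(1)] k(2) id1 by simp
  then have "Comp C k h1 = Comp C k h2"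
    using T.coequalizer_epi[OF R(3,1,2) T.Comp_hom[OF h1 k(1)] T.Comp_hom[OF h2 k(1)]] by simp
  moreover have "(b, k, (j', u, d)) \<in> hom quot_cat b (j', u, d)"
    unfolding ab using k us by (intro quot_cat_homI[OF q(2) quot e' d k(1) s]) simp_all
  ultimately show thesis
    using that[of "(b, k, (j', u, d))"] by (simp add: g1 g2 quot_cat_def)
qed

lemma filtered_quot_cat: "filtered quot_cat"
  unfolding filtered_def
proof (intro conjI ballI)
  interpret Q: category quot_cat by (rule category_quot_cat)
  obtain k where k: "k \<in> Obj J"
    using ex_cocone[of 0] by auto
  then have "is_quot k (Id C (FOb T k)) (Id C (FOb T k))"
    using is_quot_Id T.Id_hom FOb_Obj by blast
  then show "Obj quot_cat \<noteq> {}"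
    by (auto simp: quot_cat_def)
  fix a b
  assume a: "a \<in> Obj quot_cat" and b: "b \<in> Obj quot_cat"
  obtain j f e j' f' e' where ab: "a = (j, f, e)" "is_quot j f e" "b = (j', f', e')" "is_quot j' f' e'"
    using a b by (auto simp: quot_cat_def)
  obtain c g g' where "g \<in> hom quot_cat a c" "g' \<in> hom quot_cat b c"
    using quot_cat_upper_bound[OF ab(2,4)] unfolding ab by blast
  then show "\<exists>c\<in>Obj quot_cat. hom quot_cat a c \<noteq> {} \<and> hom quot_cat b c \<noteq> {}"
    using Q.hom_Obj by blast
  fix g1 g2
  assume "g1 \<in> hom quot_cat a b" "g2 \<in> hom quot_cat a b"
  then obtain c g where "g \<in> hom quot_cat b c" "Comp quot_cat g g1 = Comp quot_cat g g2"
    by (rule quot_cat_equalize)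
  then show "\<exists>c\<in>Obj quot_cat. \<exists>g\<in>hom quot_cat b c. Comp quot_cat g g1 = Comp quot_cat g g2"
    using Q.hom_Obj by blast
qed

lemma is_functor_quot_proj: "is_functor quot_cat C quot_proj"
proof -
  interpret Q: category quot_cat by (rule category_quot_cat)
  show ?thesis
  proof
    fix a
    assume "a \<in> Obj quot_cat"
    then show "FOb quot_proj a \<in> Obj C"
      by (auto simp: quot_cat_def quot_proj_def elim!: is_quotE intro: T.hom_Obj)
    show "FAr quot_proj (Id quot_cat a) = Id C (FOb quot_proj a)"
      by (simp add: quot_cat_def quot_proj_def split: prod.splits)
  next
    fix g a b
    assume "g \<in> hom quot_cat a b"
    then show "FAr quot_proj g \<in> hom C (FOb quot_proj a) (FOb quot_proj b)"
      by (rule quot_cat_hom_proj) (simp add: quot_proj_def)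
  next
    fix g g' a b c
    assume "g \<in> hom quot_cat a b" "g' \<in> hom quot_cat b c"
    then show "FAr quot_proj (Comp quot_cat g' g) = Comp C (FAr quot_proj g') (FAr quot_proj g)"
      by (elim quot_cat_hom_proj) (simp add: quot_proj_def quot_cat_def)
  qed
qed

section \<open>Final small subcategories of the category of quotients\<close>

text \<open>
  Every object of the diagram is a quotient of itself; this embeds the diagram \<open>T\<close> into \<open>quot_cat\<close>.
\<close>

definition triv :: "'j \<Rightarrow> 'j \<times> 'a \<times> 'a" where
  "triv j = (j, Id C (FOb T j), Id C (FOb T j))"

text \<open>
  The conditions make the subcategory final for cocones: it contains the image of \<open>T\<close>, and each of its
  objects \<open>(j, f, e)\<close> is linked to this image by the span of \<open>e\<close> and \<open>f\<close>. The span determines the leg at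
  \<open>(j, f, e)\<close> from the leg at \<open>triv j\<close>, since \<open>e\<close> is an epimorphism.
\<close>

definition final_arrows ::
  "(('j \<times> 'a \<times> 'a) \<times> 'a \<times> ('j \<times> 'a \<times> 'a)) set \<Rightarrow> bool" where
  "final_arrows B \<longleftrightarrow> closed_arrows quot_cat B \<and>
     (\<forall>m\<in>Arr J. (triv (Dom J m), FAr T m, triv (Cod J m)) \<in> B) \<and>
     (\<forall>(j, f, e)\<in>Obj (subcat quot_cat B).
        ((j, f, Id C (Dom C e)), e, (j, f, e)) \<in> B \<and> ((j, f, Id C (Dom C e)), f, triv j) \<in> B)"

lemma Cod_Id_T: "j \<in> Obj J \<Longrightarrow> Cod C (Id C (FOb T j)) = FOb T j"
  using T.Id_hom[OF FOb_Obj] by (simp add: hom_def)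

lemma triv_Obj:
  assumes B: "final_arrows B" and j: "j \<in> Obj J"
  shows "triv j \<in> Obj (subcat quot_cat B)"
proof -
  have "(triv j, Id C (FOb T j), triv j) \<in> B"
    using B S.Id_hom[OF j] FAr_Id[OF j] unfolding final_arrows_def hom_def by force
  moreover have "is_quot j (Id C (FOb T j)) (Id C (FOb T j))"
    using is_quot_Id[OF j] T.Id_hom FOb_Obj[OF j] by blast
  ultimately show ?thesis
    by (simp add: subcat_def quot_cat_def triv_def Cod_Id_T[OF j])
qed

context
  fixes B and D :: "('p, 'b) cat" and F :: "('o, 'a, 'p, 'b) functr"
  assumes B: "final_arrows B" and F: "is_functor C D F"
    and pres: "preserves_reflexive_coequalizers C D F"
begin

interpretation F: is_functor C D F by (rule F)

abbreviation K where "K \<equiv> subcat quot_cat B"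

interpretation KC: category K
  using category_subcat[OF category_quot_cat] B by (simp add: final_arrows_def)

lemma K_ObjE:
  assumes "a \<in> Obj K"
  obtains j f e y z R p q where "a = (j, f, e)" "FOb quot_proj a = z" "j \<in> Obj J" "Dom C e = y"
    "e \<in> hom C y z" "f \<in> hom C y (FOb T j)" "reflexive_pair C R y p q"
    "p \<in> hom C R y" "q \<in> hom C R y" "el_eq (j, Comp C f p) (j, Comp C f q)"
    "is_coequalizer C y p q z e"
proof -
  from assms obtain j f e where a: "a = (j, f, e)" "is_quot j f e"
    by (auto simp: subcat_def quot_cat_def)
  from a(2) show thesis
    by (rule is_quotE) (use a(1) that in \<open>auto simp: quot_proj_def\<close>)
qed

lemma K_epi:
  assumes "(j, f, e) \<in> Obj K"
    and "h \<in> hom D (FOb F (Cod C e)) w" "h' \<in> hom D (FOb F (Cod C e)) w"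
    and "Comp D h (FAr F e) = Comp D h' (FAr F e)"
  shows "h = h'"
  using assms(1)
proof (rule K_ObjE)
  fix j' f' e' y z R p q
  assume *: "(j, f, e) = (j', f', e')" "e' \<in> hom C y z" "reflexive_pair C R y p q"
    "p \<in> hom C R y" "q \<in> hom C R y" "is_coequalizer C y p q z e'"
  then have "is_coequalizer D (FOb F y) (FAr F p) (FAr F q) (FOb F z) (FAr F e)"
    using pres unfolding preserves_reflexive_coequalizers_def by auto
  moreover have "Cod C e = z"
    using * by (simp add: hom_def)
  ultimately show ?thesis
    using F.T.coequalizer_epi[OF _ F.FAr_hom[OF *(4)] F.FAr_hom[OF *(5)]] assms by simp
qed

lemma cocone_restrict:
  assumes "is_cocone K D (functor_comp F quot_proj) w \<sigma>"
  shows "is_cocone J D (functor_comp F T) w (\<lambda>j. \<sigma> (triv j))"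
proof -
  have "\<sigma> (triv j) \<in> hom D (FOb F (FOb T j)) w" if "j \<in> Obj J" for j
    using assms triv_Obj[OF B that] Cod_Id_T[OF that]
    by (fastforce simp: is_cocone_def functor_comp_def quot_proj_def triv_def)
  moreover have "Comp D (\<sigma> (triv (Cod J m))) (FAr F (FAr T m)) = \<sigma> (triv (Dom J m))"
    if "m \<in> Arr J" for m
  proof -
    have "(triv (Dom J m), FAr T m, triv (Cod J m)) \<in> Arr K"
      using B that by (simp add: final_arrows_def subcat_def)
    then show ?thesis
      using assms
      by (fastforce simp: is_cocone_def functor_comp_def quot_proj_def subcat_def quot_cat_def)
  qed
  ultimately show ?thesis
    using assms by (simp add: is_cocone_def functor_comp_def)
qed

lemma cocone_leg:
  assumes "is_cocone K D (functor_comp F quot_proj) w \<sigma>" and "(j, f, e) \<in> Obj K"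
  shows "Comp D (\<sigma> (j, f, e)) (FAr F e) = Comp D (\<sigma> (triv j)) (FAr F f)"
proof -
  have *: "((j, f, Id C (Dom C e)), e, (j, f, e)) \<in> Arr K" "((j, f, Id C (Dom C e)), f, triv j) \<in> Arr K"
    using B assms(2) by (auto simp: final_arrows_def subcat_def)
  have nat: "Comp D (\<sigma> b) (FAr F h) = \<sigma> a" if "(a, h, b) \<in> Arr K" for a h b
    using assms(1) that
    by (fastforce simp: is_cocone_def functor_comp_def quot_proj_def subcat_def quot_cat_def)
  show ?thesis
    using nat[OF *(1)] nat[OF *(2)] by simp
qed

text \<open>
  The composite of \<open>s j\<close> with \<open>F f\<close> coequalizes the image of the reflexive pair, as its two arrows are
  equal as elements. It therefore factors through \<open>F e\<close>, which is still a coequalizer.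
\<close>

lemma cocone_extend:
  assumes s: "is_cocone J D (functor_comp F T) w s"
  obtains \<sigma> where "is_cocone K D (functor_comp F quot_proj) w \<sigma>"
    "\<And>j. j \<in> Obj J \<Longrightarrow> \<sigma> (triv j) = s j"
proof -
  have leg: "s j \<in> hom D (FOb F (FOb T j)) w" if "j \<in> Obj J" for j
    using s that by (simp add: is_cocone_def functor_comp_def)
  have el: "Comp D (s j) (FAr F f) = Comp D (s j') (FAr F f')"
    if "el_eq (j, f) (j', f')" "j \<in> Obj J" "f \<in> hom C c (FOb T j)" for j f j' f' c
    using cocone_legs_el_eq[OF is_functor_axioms F s that] .
  have "\<exists>h. h \<in> hom D (FOb F (FOb quot_proj a)) w \<and>
      Comp D h (FAr F (snd (snd a))) = Comp D (s (fst a)) (FAr F (fst (snd a)))"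
    if "a \<in> Obj K" for a
    using that
  proof (rule K_ObjE)
    fix j f e y z R p q
    assume a: "a = (j, f, e)" "FOb quot_proj a = z" and j: "j \<in> Obj J"
      and f: "f \<in> hom C y (FOb T j)" and R: "reflexive_pair C R y p q"
      and p: "p \<in> hom C R y" and q: "q \<in> hom C R y"
      and eq: "el_eq (j, Comp C f p) (j, Comp C f q)" and e: "is_coequalizer C y p q z e"
    have coeq: "is_coequalizer D (FOb F y) (FAr F p) (FAr F q) (FOb F z) (FAr F e)"
      using pres R e unfolding preserves_reflexive_coequalizers_def by blast
    have "Comp D (Comp D (s j) (FAr F f)) (FAr F r) = Comp D (s j) (FAr F (Comp C f r))"
      if "r \<in> hom C R y" for r
      using F.T.Comp_assoc[OF F.FAr_hom[OF that] F.FAr_hom[OF f] leg[OF j]] F.FAr_Comp[OF that f]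
      by simp
    then have "Comp D (Comp D (s j) (FAr F f)) (FAr F p) = Comp D (Comp D (s j) (FAr F f)) (FAr F q)"
      using p q el[OF eq j T.Comp_hom[OF p f]] by simp
    from F.T.coequalizer_factor[OF coeq F.T.Comp_hom[OF F.FAr_hom[OF f] leg[OF j]] this]
    show ?thesis
      unfolding a by (metis a(1,2) fst_conv snd_conv)
  qed
  then obtain \<sigma> where \<sigma>: "\<And>a. a \<in> Obj K \<Longrightarrow> \<sigma> a \<in> hom D (FOb F (FOb quot_proj a)) w"
    "\<And>a. a \<in> Obj K \<Longrightarrow>
      Comp D (\<sigma> a) (FAr F (snd (snd a))) = Comp D (s (fst a)) (FAr F (fst (snd a)))"
    by metis
  have nat: "Comp D (\<sigma> b) (FAr F h) = \<sigma> a" if g: "(a, h, b) \<in> Arr K" for a h b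
  proof -
    have gQ: "(a, h, b) \<in> hom quot_cat a b" and ab: "a \<in> Obj K" "b \<in> Obj K"
    proof -
      have "(a, h, b) \<in> Arr quot_cat"
        using B g by (auto simp: final_arrows_def closed_arrows_def subcat_def)
      then show "(a, h, b) \<in> hom quot_cat a b"
        unfolding hom_def by (auto simp: quot_cat_def)
      show "a \<in> Obj K" "b \<in> Obj K"
        using KC.Dom_Obj[OF g] KC.Cod_Obj[OF g] by (simp_all add: subcat_def quot_cat_def)
    qed
    from gQ obtain j f e j' f' e' y y' z z' t where a: "a = (j, f, e)" and b: "b = (j', f', e')"
      and q: "is_quot j f e" "is_quot j' f' e'" and e: "e \<in> hom C y z" and e': "e' \<in> hom C y' z'"
      and h: "h \<in> hom C z z'" and t: "t \<in> hom C y y'" "Comp C e' t = Comp C h e"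
      and ft: "el_eq (j, f) (j', Comp C f' t)"
      by (rule quot_cat_homE) blast
    have f: "f \<in> hom C y (FOb T j)" and f': "f' \<in> hom C y' (FOb T j')" and j: "j \<in> Obj J" "j' \<in> Obj J"
      and cod: "Cod C e = z" "Cod C e' = z'"
      using q e e' by (auto simp: is_quot_def hom_def)
    have \<sigma>a: "\<sigma> a \<in> hom D (FOb F z) w" and \<sigma>b: "\<sigma> b \<in> hom D (FOb F z') w"
      using \<sigma>(1)[OF ab(1)] \<sigma>(1)[OF ab(2)] cod by (simp_all add: a b quot_proj_def)
    have "Comp D (Comp D (\<sigma> b) (FAr F h)) (FAr F e) = Comp D (Comp D (\<sigma> b) (FAr F e')) (FAr F t)"
      using F.T.Comp_assoc[OF F.FAr_hom[OF e] F.FAr_hom[OF h] \<sigma>b]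
        F.T.Comp_assoc[OF F.FAr_hom[OF t(1)] F.FAr_hom[OF e'] \<sigma>b]
        F.FAr_Comp[OF e h] F.FAr_Comp[OF t(1) e'] t(2) by simp
    also have "\<dots> = Comp D (Comp D (s j') (FAr F f')) (FAr F t)"
      using \<sigma>(2)[OF ab(2)] by (simp add: b)
    also have "\<dots> = Comp D (s j) (FAr F f)"
      using F.T.Comp_assoc[OF F.FAr_hom[OF t(1)] F.FAr_hom[OF f'] leg[OF j(2)]]
        F.FAr_Comp[OF t(1) f'] el[OF ft j(1) f] by simp
    also have "\<dots> = Comp D (\<sigma> a) (FAr F e)"
      using \<sigma>(2)[OF ab(1)] by (simp add: a)
    finally show ?thesis
      using K_epi[OF ab(1)[unfolded a], of "Comp D (\<sigma> b) (FAr F h)" w "\<sigma> a"]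
        F.T.Comp_hom[OF F.FAr_hom[OF h] \<sigma>b] \<sigma>a cod by simp
  qed
  have "is_cocone K D (functor_comp F quot_proj) w \<sigma>"
    using s \<sigma>(1) nat
    by (fastforce simp: is_cocone_def functor_comp_def quot_proj_def subcat_def quot_cat_def)
  moreover have "\<sigma> (triv j) = s j" if "j \<in> Obj J" for j
    using \<sigma>(1)[OF triv_Obj[OF B that]] \<sigma>(2)[OF triv_Obj[OF B that]] leg[OF that]
      F.FAr_Id[OF FOb_Obj[OF that]] F.T.Id_right Cod_Id_T[OF that]
    by (simp add: triv_def quot_proj_def)
  ultimately show thesis by (rule that)
qed

text \<open>
  Every cocone on the image of \<open>T\<close> is the restriction of a cocone on the subcategory. An arrow of
  vertices is compatible with two cocones iff it is compatible with their restrictions, by the spans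
  that link the objects to the image of \<open>T\<close>.
\<close>

lemma is_colimit_restrict_iff:
  assumes \<sigma>: "is_cocone K D (functor_comp F quot_proj) w \<sigma>"
  shows "is_colimit K D (functor_comp F quot_proj) w \<sigma> \<longleftrightarrow>
    is_colimit J D (functor_comp F T) w (\<lambda>j. \<sigma> (triv j))"
proof -
  have *: "(\<forall>a\<in>Obj K. Comp D h (\<sigma> a) = \<tau> a) \<longleftrightarrow>
      (\<forall>j\<in>Obj J. Comp D h (\<sigma> (triv j)) = \<tau> (triv j))"
    if \<tau>: "is_cocone K D (functor_comp F quot_proj) w' \<tau>" and h: "h \<in> hom D w w'" for \<tau> w' h
  proof
    assume "\<forall>a\<in>Obj K. Comp D h (\<sigma> a) = \<tau> a"
    then show "\<forall>j\<in>Obj J. Comp D h (\<sigma> (triv j)) = \<tau> (triv j)"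
      using triv_Obj[OF B] by blast
  next
    assume triv: "\<forall>j\<in>Obj J. Comp D h (\<sigma> (triv j)) = \<tau> (triv j)"
    show "\<forall>a\<in>Obj K. Comp D h (\<sigma> a) = \<tau> a"
    proof
      fix a
      assume a: "a \<in> Obj K"
      then show "Comp D h (\<sigma> a) = \<tau> a"
      proof (rule K_ObjE)
        fix j f e y z R p q
        assume a_eq: "a = (j, f, e)" "FOb quot_proj a = z" and j: "j \<in> Obj J"
          and f: "f \<in> hom C y (FOb T j)" and e: "e \<in> hom C y z"
        have \<sigma>a: "\<sigma> a \<in> hom D (FOb F z) w" and \<tau>a: "\<tau> a \<in> hom D (FOb F z) w'"
          using \<sigma> \<tau> a a_eq by (auto simp: is_cocone_def functor_comp_def)
        have \<sigma>j: "\<sigma> (triv j) \<in> hom D (FOb F (FOb T j)) w"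
          using cocone_restrict[OF \<sigma>] j by (simp add: is_cocone_def functor_comp_def)
        have "Comp D (Comp D h (\<sigma> a)) (FAr F e) = Comp D (Comp D h (\<sigma> (triv j))) (FAr F f)"
          using F.T.Comp_assoc[OF F.FAr_hom[OF e] \<sigma>a h] F.T.Comp_assoc[OF F.FAr_hom[OF f] \<sigma>j h]
            cocone_leg[OF \<sigma> a[unfolded a_eq(1)]] a_eq(1) by simp
        also have "\<dots> = Comp D (\<tau> a) (FAr F e)"
          using triv j cocone_leg[OF \<tau> a[unfolded a_eq(1)]] a_eq(1) by simp
        finally show "Comp D h (\<sigma> a) = \<tau> a"
          using K_epi[OF a[unfolded a_eq(1)], of "Comp D h (\<sigma> a)" w' "\<tau> a"]
            F.T.Comp_hom[OF \<sigma>a h] \<tau>a T.hom_Arr[OF e] by simp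
      qed
    qed
  qed
  show ?thesis
  proof
    assume colim: "is_colimit K D (functor_comp F quot_proj) w \<sigma>"
    have "\<exists>!h. h \<in> hom D w w' \<and> (\<forall>j\<in>Obj J. Comp D h (\<sigma> (triv j)) = s j)"
      if s: "is_cocone J D (functor_comp F T) w' s" for w' s
    proof -
      obtain \<tau> where \<tau>: "is_cocone K D (functor_comp F quot_proj) w' \<tau>"
        "\<And>j. j \<in> Obj J \<Longrightarrow> \<tau> (triv j) = s j"
        by (rule cocone_extend[OF s]) (rule that)
      have "\<exists>!h. h \<in> hom D w w' \<and> (\<forall>a\<in>Obj K. Comp D h (\<sigma> a) = \<tau> a)"
        using colim \<tau>(1) by (simp add: is_colimit_def)
      then show ?thesis
        using *[OF \<tau>(1)] \<tau>(2) by (simp cong: conj_cong)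
    qed
    with cocone_restrict[OF \<sigma>] show "is_colimit J D (functor_comp F T) w (\<lambda>j. \<sigma> (triv j))"
      by (simp add: is_colimit_def)
  next
    assume colim: "is_colimit J D (functor_comp F T) w (\<lambda>j. \<sigma> (triv j))"
    have "\<exists>!h. h \<in> hom D w w' \<and> (\<forall>a\<in>Obj K. Comp D h (\<sigma> a) = \<tau> a)"
      if \<tau>: "is_cocone K D (functor_comp F quot_proj) w' \<tau>" for w' \<tau>
    proof -
      have "\<exists>!h. h \<in> hom D w w' \<and> (\<forall>j\<in>Obj J. Comp D h (\<sigma> (triv j)) = \<tau> (triv j))"
        using colim cocone_restrict[OF \<tau>] by (simp add: is_colimit_def)
      then show ?thesis
        using *[OF \<tau>] by (simp cong: conj_cong)
    qed
    with \<sigma> show "is_colimit K D (functor_comp F quot_proj) w \<sigma>"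
      by (simp add: is_colimit_def)
  qed
qed

end

end

section \<open>Independence of the type of the index category\<close>

text \<open>
  The hypotheses on small colimits concern index categories whose objects and arrows lie in the
  type underlying \<open>\<kappa>\<close>. An injection \<open>\<iota>\<close> of the arrows into this type produces an isomorphic category
  there; an object is named by the image of its identity.
\<close>

definition relabel :: "('i \<Rightarrow> 'k) \<Rightarrow> ('j, 'i) cat \<Rightarrow> ('k, 'k) cat" where
  "relabel \<iota> G = \<lparr>Obj = (\<lambda>x. \<iota> (Id G x)) ` Obj G, Arr = \<iota> ` Arr G,
     Dom = (\<lambda>k. \<iota> (Id G (Dom G (inv_into (Arr G) \<iota> k)))),
     Cod = (\<lambda>k. \<iota> (Id G (Cod G (inv_into (Arr G) \<iota> k)))),
     Id = (\<lambda>k. k),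
     Comp = (\<lambda>g f. \<iota> (Comp G (inv_into (Arr G) \<iota> g) (inv_into (Arr G) \<iota> f)))\<rparr>"

definition relabel_diagram ::
  "('i \<Rightarrow> 'k) \<Rightarrow> ('j, 'i) cat \<Rightarrow> ('j, 'i, 'o, 'a) functr \<Rightarrow> ('k, 'k, 'o, 'a) functr" where
  "relabel_diagram \<iota> G T = \<lparr>FOb = (\<lambda>k. FOb T (Dom G (inv_into (Arr G) \<iota> k))),
     FAr = (\<lambda>k. FAr T (inv_into (Arr G) \<iota> k))\<rparr>"

lemma is_cocone_cong:
  assumes "category J" and "\<forall>j\<in>Obj J. s j = t j"
  shows "is_cocone J C T x s = is_cocone J C T x t"
proof -
  interpret category J by fact
  show ?thesis
    using assms(2) Dom_Obj Cod_Obj by (simp add: is_cocone_def)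
qed

lemma is_colimit_cong:
  assumes "category J" and "\<forall>j\<in>Obj J. s j = t j"
  shows "is_colimit J C T x s = is_colimit J C T x t"
proof -
  have "(\<forall>j\<in>Obj J. Comp C h (s j) = r j) \<longleftrightarrow> (\<forall>j\<in>Obj J. Comp C h (t j) = r j)" for h r
    using assms(2) by auto
  then show ?thesis
    using is_cocone_cong[OF assms, of C T x] by (simp add: is_colimit_def)
qed

locale relabelling = category G for G :: "('j, 'i) cat" +
  fixes \<iota> :: "'i \<Rightarrow> 'k"
  assumes inj: "inj_on \<iota> (Arr G)"
begin

lemma Id_Arr: "x \<in> Obj G \<Longrightarrow> Id G x \<in> Arr G \<and> Dom G (Id G x) = x"
  using Id_hom by (simp add: hom_def)

lemma relabel_Obj_inj:
  "\<lbrakk>x \<in> Obj G; y \<in> Obj G; \<iota> (Id G x) = \<iota> (Id G y)\<rbrakk> \<Longrightarrow> x = y"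
  using Id_Arr inj by (metis inj_onD)

lemma relabel_homI:
  assumes "f \<in> hom G x y"
  shows "\<iota> f \<in> hom (relabel \<iota> G) (\<iota> (Id G x)) (\<iota> (Id G y))"
  using assms inj unfolding hom_def by (simp add: relabel_def)

lemma relabel_homE:
  assumes "g \<in> hom (relabel \<iota> G) k l"
  obtains f x y where "f \<in> hom G x y" "g = \<iota> f" "k = \<iota> (Id G x)" "l = \<iota> (Id G y)"
  using assms inj unfolding hom_def by (auto simp: relabel_def)

lemma relabel_hom_objE:
  assumes "g \<in> hom (relabel \<iota> G) (\<iota> (Id G x)) (\<iota> (Id G y))" and "x \<in> Obj G" and "y \<in> Obj G"
  obtains f where "f \<in> hom G x y" "g = \<iota> f"
  using assms(1) by (rule relabel_homE) (metis assms(2,3) hom_Obj relabel_Obj_inj that)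

lemma relabel_Comp:
  "\<lbrakk>f \<in> hom G x y; g \<in> hom G y z\<rbrakk> \<Longrightarrow> Comp (relabel \<iota> G) (\<iota> g) (\<iota> f) = \<iota> (Comp G g f)"
  using inj by (simp add: relabel_def hom_def)

lemma relabel_ObjE:
  assumes "k \<in> Obj (relabel \<iota> G)"
  obtains x where "x \<in> Obj G" "k = \<iota> (Id G x)"
  using assms unfolding relabel_def by auto

lemma category_relabel: "category (relabel \<iota> G)"
proof
  show "Dom (relabel \<iota> G) f \<in> Obj (relabel \<iota> G)" "Cod (relabel \<iota> G) f \<in> Obj (relabel \<iota> G)"
    if "f \<in> Arr (relabel \<iota> G)" for f
    using that inj Dom_Obj Cod_Obj by (auto simp: relabel_def)
  show "Id (relabel \<iota> G) k \<in> hom (relabel \<iota> G) k k" if k: "k \<in> Obj (relabel \<iota> G)" for k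
  proof -
    obtain x where "x \<in> Obj G" "k = \<iota> (Id G x)"
      using k by (rule relabel_ObjE)
    with relabel_homI[OF Id_hom] show ?thesis by (simp add: relabel_def)
  qed
next
  fix f g k l m
  assume f: "f \<in> hom (relabel \<iota> G) k l" and g: "g \<in> hom (relabel \<iota> G) l m"
  obtain f' x y where f': "f' \<in> hom G x y" "f = \<iota> f'" "k = \<iota> (Id G x)" "l = \<iota> (Id G y)"
    using f by (rule relabel_homE)
  obtain g' y' z where g': "g' \<in> hom G y' z" "g = \<iota> g'" "l = \<iota> (Id G y')" "m = \<iota> (Id G z)"
    using g by (rule relabel_homE)
  have "y' = y"
    using relabel_Obj_inj[of y' y] f'(4) g'(3) hom_Obj f'(1) g'(1) by metis
  then show "Comp (relabel \<iota> G) g f \<in> hom (relabel \<iota> G) k m"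
    using relabel_Comp[OF f'(1)] relabel_homI[OF Comp_hom[OF f'(1)]] f' g' by simp
next
  fix f k l
  assume "f \<in> hom (relabel \<iota> G) k l"
  then obtain f' x y where f': "f' \<in> hom G x y" "f = \<iota> f'" "k = \<iota> (Id G x)" "l = \<iota> (Id G y)"
    by (rule relabel_homE)
  have "Id (relabel \<iota> G) k = \<iota> (Id G x)" "Id (relabel \<iota> G) l = \<iota> (Id G y)"
    by (simp_all add: relabel_def f')
  then show "Comp (relabel \<iota> G) (Id (relabel \<iota> G) l) f = f"
    "Comp (relabel \<iota> G) f (Id (relabel \<iota> G) k) = f"
    using relabel_Comp[OF f'(1) Id_hom] relabel_Comp[OF Id_hom f'(1)] hom_Obj[OF f'(1)]
      Id_left[OF f'(1)] Id_right[OF f'(1)] f'(2) by simp_all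
next
  fix f g h k l m n
  assume f: "f \<in> hom (relabel \<iota> G) k l" and g: "g \<in> hom (relabel \<iota> G) l m"
    and h: "h \<in> hom (relabel \<iota> G) m n"
  obtain f' x y where f': "f' \<in> hom G x y" "f = \<iota> f'" "l = \<iota> (Id G y)"
    using f by (rule relabel_homE)
  obtain g' y' z where g'0: "g' \<in> hom G y' z" "g = \<iota> g'" "l = \<iota> (Id G y')" "m = \<iota> (Id G z)"
    using g by (rule relabel_homE)
  obtain h' z' w where h'0: "h' \<in> hom G z' w" "h = \<iota> h'" "m = \<iota> (Id G z')"
    using h by (rule relabel_homE)
  have "y' = y" "z' = z"
    using relabel_Obj_inj f' g'0 h'0 hom_Obj by metis+
  then have g': "g' \<in> hom G y z" and h': "h' \<in> hom G z w"
    using g'0 h'0 by auto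
  show "Comp (relabel \<iota> G) h (Comp (relabel \<iota> G) g f) = Comp (relabel \<iota> G) (Comp (relabel \<iota> G) h g) f"
    using relabel_Comp[OF f'(1) g'] relabel_Comp[OF g' h'] relabel_Comp[OF Comp_hom[OF f'(1) g'] h']
      relabel_Comp[OF f'(1) Comp_hom[OF g' h']] Comp_assoc[OF f'(1) g' h'] f'(2) g'0(2) h'0(2)
    by simp
qed

lemma filtered_relabel:
  assumes "filtered G"
  shows "filtered (relabel \<iota> G)"
  unfolding filtered_def
proof (intro conjI ballI)
  have obj: "Obj (relabel \<iota> G) = (\<lambda>x. \<iota> (Id G x)) ` Obj G"
    by (simp add: relabel_def)
  show "Obj (relabel \<iota> G) \<noteq> {}"
    using assms by (simp add: obj filtered_def)
  fix k l
  assume "k \<in> Obj (relabel \<iota> G)" "l \<in> Obj (relabel \<iota> G)"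
  then obtain x y where k: "k = \<iota> (Id G x)" "x \<in> Obj G" and l: "l = \<iota> (Id G y)" "y \<in> Obj G"
    by (auto simp: obj)
  obtain z u v where "z \<in> Obj G" "u \<in> hom G x z" "v \<in> hom G y z"
    using assms k(2) l(2) unfolding filtered_def by blast
  then show "\<exists>m\<in>Obj (relabel \<iota> G). hom (relabel \<iota> G) k m \<noteq> {} \<and> hom (relabel \<iota> G) l m \<noteq> {}"
    using relabel_homI unfolding k l obj by blast
  fix f g
  assume "f \<in> hom (relabel \<iota> G) k l" "g \<in> hom (relabel \<iota> G) k l"
  then obtain f' g' where f': "f' \<in> hom G x y" "f = \<iota> f'" and g': "g' \<in> hom G x y" "g = \<iota> g'"
    using relabel_hom_objE k l by metis
  obtain z h where z: "z \<in> Obj G" and h: "h \<in> hom G y z" and eq: "Comp G h f' = Comp G h g'"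
    using assms k(2) l(2) f'(1) g'(1) unfolding filtered_def by blast
  have "Comp (relabel \<iota> G) (\<iota> h) f = Comp (relabel \<iota> G) (\<iota> h) g"
    using relabel_Comp[OF f'(1) h] relabel_Comp[OF g'(1) h] eq f'(2) g'(2) by simp
  then show "\<exists>m\<in>Obj (relabel \<iota> G). \<exists>h\<in>hom (relabel \<iota> G) l m.
      Comp (relabel \<iota> G) h f = Comp (relabel \<iota> G) h g"
    using relabel_homI[OF h] z unfolding l obj by blast
qed

lemma is_functor_relabel_diagram:
  assumes "is_functor G C T"
  shows "is_functor (relabel \<iota> G) C (relabel_diagram \<iota> G T)"
proof -
  interpret F: is_functor G C T by fact
  interpret R: category "relabel \<iota> G" by (rule category_relabel)
  show ?thesis
  proof
    fix k
    assume "k \<in> Obj (relabel \<iota> G)"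
    then obtain x where x: "x \<in> Obj G" "k = \<iota> (Id G x)"
      by (rule relabel_ObjE)
    then show "FOb (relabel_diagram \<iota> G T) k \<in> Obj C"
      "FAr (relabel_diagram \<iota> G T) (Id (relabel \<iota> G) k) = Id C (FOb (relabel_diagram \<iota> G T) k)"
      using Id_Arr[OF x(1)] x inj F.FOb_Obj F.FAr_Id by (simp_all add: relabel_diagram_def relabel_def)
  next
    fix f k l
    assume "f \<in> hom (relabel \<iota> G) k l"
    then obtain f' x y where f': "f' \<in> hom G x y" "f = \<iota> f'" "k = \<iota> (Id G x)" "l = \<iota> (Id G y)"
      by (rule relabel_homE)
    then show "FAr (relabel_diagram \<iota> G T) f \<in>
        hom C (FOb (relabel_diagram \<iota> G T) k) (FOb (relabel_diagram \<iota> G T) l)"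
      using F.FAr_hom[OF f'(1)] hom_Obj[OF f'(1)] Id_Arr inj hom_Arr[OF f'(1)]
      by (simp add: relabel_diagram_def)
  next
    fix f g k l m
    assume f: "f \<in> hom (relabel \<iota> G) k l" and g: "g \<in> hom (relabel \<iota> G) l m"
    obtain f' x y where f': "f' \<in> hom G x y" "f = \<iota> f'" "l = \<iota> (Id G y)"
      using f by (rule relabel_homE)
    have "m \<in> Obj (relabel \<iota> G)"
      using R.hom_Obj[OF g] by simp
    then obtain z where z: "z \<in> Obj G" "m = \<iota> (Id G z)"
      by (rule relabel_ObjE)
    obtain g' where g': "g' \<in> hom G y z" "g = \<iota> g'"
      using g relabel_hom_objE f'(3) z hom_Obj[OF f'(1)] by metis
    show "FAr (relabel_diagram \<iota> G T) (Comp (relabel \<iota> G) g f) =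
        Comp C (FAr (relabel_diagram \<iota> G T) g) (FAr (relabel_diagram \<iota> G T) f)"
      using relabel_Comp[OF f'(1) g'(1)] F.FAr_Comp[OF f'(1) g'(1)] inj
        hom_Arr[OF f'(1)] hom_Arr[OF g'(1)] hom_Arr[OF Comp_hom[OF f'(1) g'(1)]]
      by (simp add: f'(2) g'(2) relabel_diagram_def)
  qed
qed

lemma is_cocone_relabel:
  "is_cocone (relabel \<iota> G) C (relabel_diagram \<iota> G T) x t \<longleftrightarrow> is_cocone G C T x (\<lambda>g. t (\<iota> (Id G g)))"
  using inj Id_Arr by (simp add: is_cocone_def relabel_def relabel_diagram_def)

lemma is_colimit_relabel:
  "is_colimit (relabel \<iota> G) C (relabel_diagram \<iota> G T) x t \<longleftrightarrow>
    is_colimit G C T x (\<lambda>g. t (\<iota> (Id G g)))"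
proof -
  have obj: "(\<forall>k\<in>Obj (relabel \<iota> G). P k) \<longleftrightarrow> (\<forall>g\<in>Obj G. P (\<iota> (Id G g)))" for P
    by (simp add: relabel_def)
  show ?thesis
  proof
    assume colim: "is_colimit (relabel \<iota> G) C (relabel_diagram \<iota> G T) x t"
    have "\<exists>!h. h \<in> hom C x y \<and> (\<forall>g\<in>Obj G. Comp C h (t (\<iota> (Id G g))) = s g)"
      if s: "is_cocone G C T y s" for y s
    proof -
      define s' where "s' k = s (Dom G (inv_into (Arr G) \<iota> k))" for k
      have s': "s' (\<iota> (Id G g)) = s g" if "g \<in> Obj G" for g
        using that Id_Arr inj by (simp add: s'_def)
      then have "is_cocone (relabel \<iota> G) C (relabel_diagram \<iota> G T) y s'"
        using s is_cocone_cong[OF category_axioms, of "\<lambda>g. s' (\<iota> (Id G g))" s C T y]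
        by (simp add: is_cocone_relabel)
      then have "\<exists>!h. h \<in> hom C x y \<and> (\<forall>g\<in>Obj G. Comp C h (t (\<iota> (Id G g))) = s' (\<iota> (Id G g)))"
        using colim by (simp add: is_colimit_def obj)
      moreover have "(\<forall>g\<in>Obj G. Comp C h (t (\<iota> (Id G g))) = s' (\<iota> (Id G g))) \<longleftrightarrow>
          (\<forall>g\<in>Obj G. Comp C h (t (\<iota> (Id G g))) = s g)" for h
        using s' by auto
      ultimately show ?thesis by simp
    qed
    then show "is_colimit G C T x (\<lambda>g. t (\<iota> (Id G g)))"
      using colim by (simp add: is_colimit_def is_cocone_relabel)
  qed (simp add: is_colimit_def is_cocone_relabel obj)
qed

end

lemma ex_relabelling:
  fixes \<kappa> :: "'k rel"
  assumes "category (G :: ('j, 'i) cat)" and "|Arr G| <o \<kappa>" and "Card_order \<kappa>"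
  shows "\<exists>\<iota> :: 'i \<Rightarrow> 'k. relabelling G \<iota> \<and> small_cat \<kappa> (relabel \<iota> G)"
proof -
  have "|Arr G| \<le>o |Field \<kappa>|"
    using assms(2,3)
    by (meson card_of_Field_ordIso ordIso_symmetric ordLess_imp_ordLeq ordLeq_ordIso_trans)
  then obtain \<iota> :: "'i \<Rightarrow> 'k" where "inj_on \<iota> (Arr G)"
    unfolding card_of_ordLeq[symmetric] by auto
  then have "relabelling G \<iota>"
    using assms(1) by (simp add: relabelling_def relabelling_axioms_def)
  moreover have "small_cat \<kappa> (relabel \<iota> G)"
    using card_of_image assms(2) by (auto simp: small_cat_def relabel_def intro: ordLeq_ordLess_trans)
  ultimately show ?thesis by blast
qed

lemma filtered_colimit_exists:
  fixes \<kappa> :: "'k rel"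
  assumes "has_small_colimits \<kappa> filtered C" and "Card_order \<kappa>"
    and "|Arr G| <o \<kappa>" and "filtered G" and T: "is_functor G C T"
  obtains x t where "is_colimit G C T x t"
proof -
  have "category G"
    using T by (simp add: is_functor_def)
  then obtain \<iota> :: "_ \<Rightarrow> 'k" where "relabelling G \<iota>" and small: "small_cat \<kappa> (relabel \<iota> G)"
    using ex_relabelling[OF _ assms(3,2)] by blast
  interpret relabelling G \<iota> by fact
  obtain x t where "is_colimit (relabel \<iota> G) C (relabel_diagram \<iota> G T) x t"
    using assms(1) small category_relabel filtered_relabel[OF assms(4)] is_functor_relabel_diagram[OF T]
    unfolding has_small_colimits_def by blast
  with that show thesis
    unfolding is_colimit_relabel by blast
qed

lemma filtered_colimit_preserved:
  fixes \<kappa> :: "'k rel"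
  assumes "preserves_small_colimits \<kappa> filtered C D F" and "Card_order \<kappa>"
    and "|Arr G| <o \<kappa>" and "filtered G" and T: "is_functor G C T" and colim: "is_colimit G C T x t"
  shows "is_colimit G D (functor_comp F T) (FOb F x) (\<lambda>g. FAr F (t g))"
proof -
  have "category G"
    using T by (simp add: is_functor_def)
  then obtain \<iota> :: "_ \<Rightarrow> 'k" where "relabelling G \<iota>" and small: "small_cat \<kappa> (relabel \<iota> G)"
    using ex_relabelling[OF _ assms(3,2)] by blast
  interpret relabelling G \<iota> by fact
  define t' where "t' k = t (Dom G (inv_into (Arr G) \<iota> k))" for k
  have t': "t' (\<iota> (Id G g)) = t g" if "g \<in> Obj G" for g
    using that Id_Arr inj by (simp add: t'_def)
  then have "is_colimit (relabel \<iota> G) C (relabel_diagram \<iota> G T) x t'"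
    using colim is_colimit_cong[OF category_axioms, of "\<lambda>g. t' (\<iota> (Id G g))" t C T x]
    by (simp add: is_colimit_relabel)
  then have "is_colimit (relabel \<iota> G) D (functor_comp F (relabel_diagram \<iota> G T)) (FOb F x)
      (\<lambda>k. FAr F (t' k))"
    using assms(1) small category_relabel filtered_relabel[OF assms(4)] is_functor_relabel_diagram[OF T]
    unfolding preserves_small_colimits_def by blast
  moreover have "functor_comp F (relabel_diagram \<iota> G T) = relabel_diagram \<iota> G (functor_comp F T)"
    by (simp add: functor_comp_def relabel_diagram_def comp_def)
  ultimately have "is_colimit G D (functor_comp F T) (FOb F x) (\<lambda>g. FAr F (t' (\<iota> (Id G g))))"
    by (simp add: is_colimit_relabel)
  then show ?thesis
    using is_colimit_cong[OF category_axioms, of "\<lambda>g. FAr F (t' (\<iota> (Id G g)))" "\<lambda>g. FAr F (t g)"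
        D "functor_comp F T" "FOb F x"] t' by simp
qed

section \<open>Sifted colimits from filtered colimits and reflexive coequalizers\<close>

text \<open>
  The closure starts from the image of \<open>J\<close>. The two arrows of the span at an object are the additional
  closure condition; it is imposed on an arrow for its domain, and so at every object for its identity.
\<close>

lemma (in sifted_quotients) ex_small_final_arrows:
  fixes \<kappa> :: "'k rel"
  assumes \<kappa>: "Card_order \<kappa>" "natLeq <o \<kappa>" and small: "|Arr J| <o \<kappa>"
  obtains B where "final_arrows B" "filtered (subcat quot_cat B)" "|B| <o \<kappa>"
proof -
  let ?A = "(\<lambda>m. (triv (Dom J m), FAr T m, triv (Cod J m))) ` Arr J"
  define N where "N = (\<lambda>((j, f, e), h :: 'a, b :: 'j \<times> 'a \<times> 'a).
     {((j, f, Id C (Dom C e)), e, (j, f, e)), ((j, f, Id C (Dom C e)), f, triv j)})"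
  have triv: "is_quot j (Id C (FOb T j)) (Id C (FOb T j))" if "j \<in> Obj J" for j
    using is_quot_Id[OF that] T.Id_hom FOb_Obj[OF that] by blast
  have "?A \<subseteq> Arr quot_cat"
  proof (rule image_subsetI)
    fix m
    assume m: "m \<in> Arr J"
    let ?x = "FOb T (Dom J m)" and ?y = "FOb T (Cod J m)"
    have Tm: "FAr T m \<in> hom C ?x ?y"
      using FAr_hom[OF S.in_hom[OF m]] .
    have one: "Id C ?x \<in> hom C ?x ?x" "Id C ?y \<in> hom C ?y ?y"
      using T.Id_hom T.hom_Obj[OF Tm] by auto
    have "el_eq (Dom J m, Id C ?x) (Cod J m, Comp C (Id C ?y) (FAr T m))"
      using el_eq_map[OF S.in_hom[OF m] one(1)] T.Id_left[OF Tm] T.Id_right[OF Tm] by simp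
    then have "(triv (Dom J m), FAr T m, triv (Cod J m)) \<in>
        hom quot_cat (triv (Dom J m)) (triv (Cod J m))"
      unfolding triv_def using T.Id_left[OF Tm] T.Id_right[OF Tm]
      by (intro quot_cat_homI[OF triv triv one Tm Tm] S.Dom_Obj S.Cod_Obj m) simp_all
    then show "(triv (Dom J m), FAr T m, triv (Cod J m)) \<in> Arr quot_cat"
      by (simp add: hom_def)
  qed
  moreover have "?A \<noteq> {}"
  proof -
    obtain k where "k \<in> Obj J"
      using ex_cocone[of 0] by auto
    then show ?thesis
      using S.Id_hom by (auto simp: hom_def)
  qed
  moreover have "|?A| <o \<kappa>"
    using card_of_image small by (rule ordLeq_ordLess_trans)
  moreover have "finite (N g) \<and> N g \<subseteq> Arr quot_cat" if g_arr: "g \<in> Arr quot_cat" for g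
  proof -
    obtain j f e h j' f' e' where g: "g = ((j, f, e), h, (j', f', e'))" and q: "is_quot j f e"
      using g_arr by (auto simp: quot_cat_def)
    obtain y z where j: "j \<in> Obj J" and f: "f \<in> hom C y (FOb T j)" and e: "e \<in> hom C y z"
      and dom: "Dom C e = y"
      using q by (rule is_quotE) blast
    have one: "Id C y \<in> hom C y y" "Id C (FOb T j) \<in> hom C (FOb T j) (FOb T j)"
      using T.Id_hom T.hom_Obj[OF f] by auto
    have "((j, f, Id C y), e, (j, f, e)) \<in> hom quot_cat (j, f, Id C y) (j, f, e)"
      using T.Id_right[OF f] T.Id_right[OF e]
      by (intro quot_cat_homI[OF is_quot_Id[OF j f] q one(1) e e one(1)]) simp_all
    moreover have "((j, f, Id C y), f, triv j) \<in> hom quot_cat (j, f, Id C y) (triv j)"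
      unfolding triv_def using T.Id_right[OF f] T.Id_left[OF f]
      by (intro quot_cat_homI[OF is_quot_Id[OF j f] triv[OF j] one f f]) simp_all
    ultimately show ?thesis
      by (simp add: N_def g dom hom_def)
  qed
  ultimately obtain B where B: "?A \<subseteq> B" "closed_arrows quot_cat B" "filtered (subcat quot_cat B)"
    "|B| <o \<kappa>" and N: "\<forall>g\<in>B. N g \<subseteq> B"
    by (rule small_filtered_subcat[OF category_quot_cat filtered_quot_cat _ _ _ \<kappa>])
  have "((j, f, Id C (Dom C e)), e, (j, f, e)) \<in> B \<and> ((j, f, Id C (Dom C e)), f, triv j) \<in> B"
    if "(j, f, e) \<in> Obj (subcat quot_cat B)" for j f e
  proof -
    have "((j, f, e), Id C (Cod C e), (j, f, e)) \<in> B"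
      using that by (simp add: subcat_def quot_cat_def)
    from bspec[OF N this] show ?thesis by (simp add: N_def)
  qed
  then have "final_arrows B"
    using B(1,2) unfolding final_arrows_def by blast
  from that[OF this B(3,4)] show thesis .
qed

lemma (in category) is_functor_identity: "is_functor C C \<lparr>FOb = id, FAr = id\<rparr>"
  by unfold_locales auto

lemma functor_comp_identity: "functor_comp \<lparr>FOb = id, FAr = id\<rparr> T = T"
  by (cases T) (simp add: functor_comp_def)

lemma preserves_reflexive_coequalizers_identity:
  "preserves_reflexive_coequalizers C C \<lparr>FOb = id, FAr = id\<rparr>"
  by (simp add: preserves_reflexive_coequalizers_def)

context sifted_quotients
begin

lemmas identity_facts =
  T.is_functor_identity preserves_reflexive_coequalizers_identity

text \<open>
  The identity functor turns \<open>is_colimit_restrict_iff\<close> into a statement about \<open>C\<close> itself.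
\<close>

lemma sifted_colimit_exists:
  fixes \<kappa> :: "'k rel"
  assumes "has_small_colimits \<kappa> filtered C" and \<kappa>: "Card_order \<kappa>" "natLeq <o \<kappa>"
    and small: "|Arr J| <o \<kappa>"
  shows "\<exists>x t. is_colimit J C T x t"
proof -
  obtain B where B: "final_arrows B" "filtered (subcat quot_cat B)" "|B| <o \<kappa>"
    using \<kappa> small by (rule ex_small_final_arrows)
  have closed: "closed_arrows quot_cat B"
    using B(1) by (simp add: final_arrows_def)
  obtain x \<sigma> where \<sigma>: "is_colimit (subcat quot_cat B) C quot_proj x \<sigma>"
  proof (rule filtered_colimit_exists[OF assms(1) \<kappa>(1) _ B(2)])
    show "|Arr (subcat quot_cat B)| <o \<kappa>"
      using B(3) by (simp add: subcat_def)
    show "is_functor (subcat quot_cat B) C quot_proj"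
      using is_functor_quot_proj closed by (rule is_functor_subcat)
  qed (rule that)
  then have "is_cocone (subcat quot_cat B) C quot_proj x \<sigma>"
    by (simp add: is_colimit_def)
  with \<sigma> show ?thesis
    using is_colimit_restrict_iff[OF B(1) identity_facts, of x \<sigma>]
    by (auto simp: functor_comp_identity)
qed

text \<open>
  The given colimit of \<open>T\<close> extends to a filtered colimit in \<open>C\<close>, which \<open>F\<close> preserves, and its image
  restricts to a colimit of the image of \<open>T\<close>.
\<close>

lemma sifted_colimit_preserved:
  fixes \<kappa> :: "'k rel"
  assumes F: "is_functor C D F" and refl: "preserves_reflexive_coequalizers C D F"
    and filt: "preserves_small_colimits \<kappa> filtered C D F"
    and \<kappa>: "Card_order \<kappa>" "natLeq <o \<kappa>" and small: "|Arr J| <o \<kappa>"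
    and t: "is_colimit J C T x t"
  shows "is_colimit J D (functor_comp F T) (FOb F x) (\<lambda>j. FAr F (t j))"
proof -
  obtain B where B: "final_arrows B" "filtered (subcat quot_cat B)" "|B| <o \<kappa>"
    using \<kappa> small by (rule ex_small_final_arrows)
  have closed: "closed_arrows quot_cat B"
    using B(1) by (simp add: final_arrows_def)
  have cocone: "is_cocone J C (functor_comp \<lparr>FOb = id, FAr = id\<rparr> T) x t"
    using t by (simp add: is_colimit_def functor_comp_identity)
  obtain \<sigma> where \<sigma>: "is_cocone (subcat quot_cat B) C quot_proj x \<sigma>"
    and triv: "\<And>j. j \<in> Obj J \<Longrightarrow> \<sigma> (triv j) = t j"
    using cocone_extend[OF B(1) identity_facts cocone] unfolding functor_comp_identity by metis
  have "is_colimit J C T x (\<lambda>j. \<sigma> (triv j))"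
    using t triv is_colimit_cong[OF S.category_axioms, of "\<lambda>j. \<sigma> (triv j)" t C T x] by simp
  then have "is_colimit (subcat quot_cat B) C quot_proj x \<sigma>"
    using is_colimit_restrict_iff[OF B(1) identity_facts, of x \<sigma>] \<sigma>
    by (simp add: functor_comp_identity)
  then have F\<sigma>: "is_colimit (subcat quot_cat B) D (functor_comp F quot_proj) (FOb F x) (\<lambda>a. FAr F (\<sigma> a))"
    using filtered_colimit_preserved[OF filt \<kappa>(1) _ B(2) is_functor_subcat[OF is_functor_quot_proj closed]]
      B(3) by (simp add: subcat_def)
  then have "is_cocone (subcat quot_cat B) D (functor_comp F quot_proj) (FOb F x) (\<lambda>a. FAr F (\<sigma> a))"
    by (simp add: is_colimit_def)
  then have "is_colimit J D (functor_comp F T) (FOb F x) (\<lambda>j. FAr F (\<sigma> (triv j)))"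
    using is_colimit_restrict_iff[OF B(1) F refl] F\<sigma> by blast
  then show ?thesis
    using triv is_colimit_cong[OF S.category_axioms, of "\<lambda>j. FAr F (\<sigma> (triv j))" "\<lambda>j. FAr F (t j)"
        D "functor_comp F T" "FOb F x"] by simp
qed

end

(* U is the cardinal bound of the universe of small sets. Only its regularity is assumed. *)
theorem corollary5p2:
  fixes \<kappa> :: "'k rel" and U :: "'u rel"
    and C :: "('o, 'a) cat" and D :: "('p, 'b) cat"
  assumes "Card_order U" and "regularCard U"
    and "Card_order \<kappa>" and "regularCard \<kappa>" and "natLeq <o \<kappa>" and "\<kappa> \<le>o U"
    and "category C" and "locally_small U C"
    and "has_pullbacks C"
    and "has_reflexive_coequalizers C"
    and "has_small_colimits \<kappa> filtered C"
  shows "has_small_colimits \<kappa> sifted C \<and>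
    (category D \<and> locally_small U D \<longrightarrow>
      (\<forall>F. is_functor C D F \<and> preserves_reflexive_coequalizers C D F \<and>
           preserves_small_colimits \<kappa> filtered C D F \<longrightarrow>
         preserves_small_colimits \<kappa> sifted C D F))"
proof (intro conjI impI allI)
  have diagram: "sifted_quotients J C T" if "sifted J" "is_functor J C T"
    for J :: "('k, 'k) cat" and T
    using that assms by (simp add: sifted_quotients_def sifted_quotients_axioms_def
        sifted_diagram_def sifted_diagram_axioms_def)
  show "has_small_colimits \<kappa> sifted C"
    unfolding has_small_colimits_def small_cat_def
    using sifted_quotients.sifted_colimit_exists[OF diagram] assms by blast
  fix F
  assume "is_functor C D F \<and> preserves_reflexive_coequalizers C D F \<and>
    preserves_small_colimits \<kappa> filtered C D F"
  then show "preserves_small_colimits \<kappa> sifted C D F"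
    unfolding preserves_small_colimits_def[of \<kappa> sifted] small_cat_def
    using sifted_quotients.sifted_colimit_preserved[OF diagram] assms by blast
qed

end
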